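(* Let $m=(m_0,m_1,\dots)$ be an arbitrary (bounded or unbounded) sequence of integers with $m_k\ge 2$ for all $k$, let $G_m$ be the associated Vilenkin group, let $H_1=H_1(G_m)$ be the atomic Hardy space on $G_m$, and let $S_kf$ denote the $k$-th partial sum of the Vilenkin–Fourier series of $f$. a) There exists an absolute constant $c>0$ (not depending on $m$, on $f$ or on $n$) such that for every $f\in H_1$ $$\sup_{n\ge 2}\ \frac{1}{n\log n}\sum_{k=1}^{n}\|S_kf\|_1\ \le\ c\,\|f\|_{H_1}.$$ b) Let $\varphi:\mathbb{N}_+\to[1,\infty)$, $n\mapsto\varphi_n$, be a nondecreasing function satisfying $$\limsup_{n\to\infty}\frac{\log n}{\varphi_n}=+\infty .$$ Then there exists a function $f\in H_1$ such that $$\sup_{n\in\mathbb{N}_+}\ \frac{1}{n\varphi_n}\sum_{k=1}^{n}\|S_kf\|_1=\infty .$$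
   Context: $\mathbb{N}_+$ is the set of positive integers and $\mathbb{N}=\mathbb{N}_+\cup\{0\}$. Vilenkin group. For a sequence $m=(m_0,m_1,\dots)$ of integers $m_k\ge 2$, let $Z_{m_k}=\{0,1,\dots,m_k-1\}$ be the additive group of integers modulo $m_k$ with the discrete topology, and let $G_m=\prod_{k=0}^\infty Z_{m_k}$ be the complete direct product with the product topology. Its elements are sequences $x=(x_0,x_1,\dots)$ with $x_k\in Z_{m_k}$. Let $\mu$ be the normalized Haar measure on $G_m$, i.e. the product of the uniform probability measures on the $Z_{m_k}$. The norm $\|\cdot\|_1$ is that of $L_1(G_m)=L_1(G_m,\mu)$ (complex-valued functions). Vilenkin system. Put $M_0=1$, $M_{k+1}=m_kM_k$. Every $n\in\mathbb{N}$ is uniquely $n=\sum_{j\ge0}n_jM_j$ with $n_j\in Z_{m_j}$, only finitely many $n_j$ nonzero. Let $r_k(x)=\exp(2\pi i x_k/m_k)$ and $\psi_n(x)=\prod_{k=0}^\infty r_k(x)^{n_k}$. For $f\in L_1(G_m)$ put $\widehat f(k)=\int_{G_m}f\,\overline{\psi_k}\,d\mu$ for $k\in\mathbb{N}$, and $S_nf=\sum_{k=0}^{n-1}\widehat f(k)\psi_k$ for $n\in\mathbb{N}_+$. Intervals. For $x\in G_m$, $n\in\mathbb{N}$, $k\in Z_{m_n}$ let $I_n(x,k)=\{y\in G_m: y_0=x_0,\dots,y_{n-1}=x_{n-1},\ y_n=k\}$. A set $I\subset G_m$ is an interval if $I=\bigcup_{k\in U}I_n(x,k)$ for some $x\in G_m$,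 $n\in\mathbb{N}$ and some $U\subset Z_{m_n}$ obtained from $Z_{m_n}$ by dyadic partition. This means that $U$ belongs to the smallest family of subsets of $Z_{m_n}$ which contains $Z_{m_n}$ itself and which, with every block $\{a,a+1,\dots,a+\ell-1\}$ of $\ell\ge2$ consecutive elements in it, also contains the two blocks $\{a,\dots,a+\lfloor \ell/2\rfloor-1\}$ and $\{a+\lfloor \ell/2\rfloor,\dots,a+\ell-1\}$. Write $|I|=\mu(I)$. Hardy space. A function $a\in L^\infty(G_m)$ is an atom if either $a\equiv1$, or there is an interval $I$ such that $\operatorname{supp}a\subset I$, $|a|\le|I|^{-1}$ and $\int_I a\,d\mu=0$. The space $H_1(G_m)$ consists of all functions $f=\sum_{i=0}^\infty\lambda_ia_i$ (convergence in $L_1(G_m)$), where the $a_i$ are atoms and the $\lambda_i$ are complex numbers with $\sum_{i=0}^\infty|\lambda_i|<\infty$. It is normed by $\|f\|_{H_1}=\inf\sum_{i=0}^\infty|\lambda_i|$, the infimum being over all such decompositions of $f$. In particular $H_1(G_m)\subset L_1(G_m)$. *)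

theory Defs
  imports "HOL-Probability.Probability"
begin

text \<open>
  Elements of the group are functions \<open>x :: nat \<Rightarrow> nat\<close> with \<open>x k < m k\<close>. The measurable sets of the
  product measure are the Borel sets of the product topology, and the product of the uniform
  probability measures is the normalized Haar measure.
\<close>

definition vilenkin_group :: "(nat \<Rightarrow> nat) \<Rightarrow> (nat \<Rightarrow> nat) measure" where
  "vilenkin_group m = PiM UNIV (\<lambda>k. uniform_count_measure {..<m k})"

definition L1_norm :: "(nat \<Rightarrow> nat) \<Rightarrow> ((nat \<Rightarrow> nat) \<Rightarrow> complex) \<Rightarrow> real" where
  "L1_norm m f = (LINT x|vilenkin_group m. norm (f x))"

definition gen_power :: "(nat \<Rightarrow> nat) \<Rightarrow> nat \<Rightarrow> nat" where
  "gen_power m k = (\<Prod>j<k. m j)"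

definition digit :: "(nat \<Rightarrow> nat) \<Rightarrow> nat \<Rightarrow> nat \<Rightarrow> nat" where
  "digit m n j = n div gen_power m j mod m j"

lemma gen_power_simps: "gen_power m 0 = 1" "gen_power m (Suc k) = m k * gen_power m k"
  by (simp_all add: gen_power_def mult.commute)

lemma digit_less:
  assumes "\<And>k. m k \<ge> 2"
  shows "digit m n j < m j"
  using assms[of j] by (simp add: digit_def)

lemma less_gen_power:
  assumes m: "\<And>k. m k \<ge> 2"
  shows "k < gen_power m k"
proof -
  have "2 ^ k \<le> gen_power m k"
  proof (induction k)
    case (Suc k)
    then show ?case
      using mult_le_mono[OF m[of k] Suc] by (simp only: gen_power_simps power_Suc)
  qed (simp add: gen_power_simps)
  then show ?thesis
    by (rule less_le_trans[OF less_exp])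
qed

lemma digit_eq_0:
  assumes "\<And>k. m k \<ge> 2" and "n \<le> j"
  shows "digit m n j = 0"
  using le_less_trans[OF assms(2) less_gen_power[OF assms(1)]] by (simp add: digit_def)

lemma digit_expansion_aux:
  "(\<Sum>j<k. digit m n j * gen_power m j) + n div gen_power m k * gen_power m k = n"
proof (induction k)
  case (Suc k)
  have "n div gen_power m (Suc k) = n div gen_power m k div m k"
    by (metis gen_power_simps(2) div_mult2_eq mult.commute)
  then have "n div gen_power m (Suc k) * gen_power m (Suc k)
      = n div gen_power m k div m k * m k * gen_power m k"
    by (simp only: gen_power_simps mult.assoc)
  then have "digit m n k * gen_power m k + n div gen_power m (Suc k) * gen_power m (Suc k)
      = (n div gen_power m k mod m k + n div gen_power m k div m k * m k) * gen_power m k"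
    by (simp only: digit_def distrib_right)
  also have "\<dots> = n div gen_power m k * gen_power m k"
    by simp
  finally show ?case
    using Suc by simp
qed (simp add: gen_power_simps)

text \<open>The numbers \<open>digit m n j\<close> are the digits of \<open>n\<close> in the mixed radix system given by \<open>m\<close>.\<close>

lemma
  assumes m: "\<And>k. m k \<ge> 2"
  shows finite_digits: "finite {k. digit m n k \<noteq> 0}"
    and digit_expansion: "(\<Sum>k | digit m n k \<noteq> 0. digit m n k * gen_power m k) = n"
proof -
  have sub: "{k. digit m n k \<noteq> 0} \<subseteq> {..<n}"
  proof
    fix k
    assume "k \<in> {k. digit m n k \<noteq> 0}"
    then show "k \<in> {..<n}"
      using digit_eq_0[of m n k] m by fastforce
  qed
  then show "finite {k. digit m n k \<noteq> 0}"
    by (rule finite_subset) simp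
  have "n < gen_power m n"
    using m by (rule less_gen_power)
  then have "(\<Sum>j<n. digit m n j * gen_power m j) = n"
    using digit_expansion_aux[where k = n and m = m and n = n] by simp
  moreover have "(\<Sum>k | digit m n k \<noteq> 0. digit m n k * gen_power m k)
      = (\<Sum>j<n. digit m n j * gen_power m j)"
    by (rule sum.mono_neutral_left) (use sub in auto)
  ultimately show "(\<Sum>k | digit m n k \<noteq> 0. digit m n k * gen_power m k) = n"
    by simp
qed

definition rademacher :: "(nat \<Rightarrow> nat) \<Rightarrow> nat \<Rightarrow> (nat \<Rightarrow> nat) \<Rightarrow> complex" where
  "rademacher m k x = exp (2 * of_real pi * \<i> * of_nat (x k) / of_nat (m k))"

text \<open>
  All omitted factors of the infinite product equal 1; by \<open>finite_digits\<close> the index set is finite.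
\<close>

definition vilenkin :: "(nat \<Rightarrow> nat) \<Rightarrow> nat \<Rightarrow> (nat \<Rightarrow> nat) \<Rightarrow> complex" where
  "vilenkin m n x = (\<Prod>k | digit m n k \<noteq> 0. rademacher m k x ^ digit m n k)"

definition fourier_coeff :: "(nat \<Rightarrow> nat) \<Rightarrow> ((nat \<Rightarrow> nat) \<Rightarrow> complex) \<Rightarrow> nat \<Rightarrow> complex" where
  "fourier_coeff m f k = (LINT x|vilenkin_group m. f x * cnj (vilenkin m k x))"

definition partial_sum ::
    "(nat \<Rightarrow> nat) \<Rightarrow> nat \<Rightarrow> ((nat \<Rightarrow> nat) \<Rightarrow> complex) \<Rightarrow> (nat \<Rightarrow> nat) \<Rightarrow> complex" where
  "partial_sum m n f x = (\<Sum>k<n. fourier_coeff m f k * vilenkin m k x)"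

inductive_set dyadic_blocks :: "nat \<Rightarrow> nat set set" for N :: nat where
  whole: "{0..<N} \<in> dyadic_blocks N"
| left: "{a..<a + l} \<in> dyadic_blocks N \<Longrightarrow> l \<ge> 2 \<Longrightarrow> {a..<a + l div 2} \<in> dyadic_blocks N"
| right: "{a..<a + l} \<in> dyadic_blocks N \<Longrightarrow> l \<ge> 2 \<Longrightarrow> {a + l div 2..<a + l} \<in> dyadic_blocks N"

definition cylinder :: "(nat \<Rightarrow> nat) \<Rightarrow> nat \<Rightarrow> (nat \<Rightarrow> nat) \<Rightarrow> nat \<Rightarrow> (nat \<Rightarrow> nat) set" where
  "cylinder m n x k = {y \<in> space (vilenkin_group m). (\<forall>i<n. y i = x i) \<and> y n = k}"

definition vilenkin_interval :: "(nat \<Rightarrow> nat) \<Rightarrow> (nat \<Rightarrow> nat) set \<Rightarrow> bool" where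
  "vilenkin_interval m I \<longleftrightarrow>
    (\<exists>x \<in> space (vilenkin_group m). \<exists>n. \<exists>U \<in> dyadic_blocks (m n). I = (\<Union>k\<in>U. cylinder m n x k))"

text \<open>
  Elements of the Lebesgue spaces are represented by functions, so conditions on them are imposed
  almost everywhere.
\<close>

definition atom :: "(nat \<Rightarrow> nat) \<Rightarrow> ((nat \<Rightarrow> nat) \<Rightarrow> complex) \<Rightarrow> bool" where
  "atom m a \<longleftrightarrow>
    a \<in> borel_measurable (vilenkin_group m) \<and>
    (\<exists>C. AE x in vilenkin_group m. norm (a x) \<le> C) \<and>
    ((AE x in vilenkin_group m. a x = 1) \<or>
     (\<exists>I. vilenkin_interval m I \<and>
          (AE x in vilenkin_group m. x \<notin> I \<longrightarrow> a x = 0) \<and>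
          (AE x in vilenkin_group m. norm (a x) \<le> 1 / measure (vilenkin_group m) I) \<and>
          (LINT x:I|vilenkin_group m. a x) = 0))"

definition atomic_decomposition ::
    "(nat \<Rightarrow> nat) \<Rightarrow> ((nat \<Rightarrow> nat) \<Rightarrow> complex) \<Rightarrow> (nat \<Rightarrow> complex) \<Rightarrow>
      (nat \<Rightarrow> (nat \<Rightarrow> nat) \<Rightarrow> complex) \<Rightarrow> bool" where
  "atomic_decomposition m f c a \<longleftrightarrow>
    (\<forall>i. atom m (a i)) \<and>
    summable (\<lambda>i. norm (c i)) \<and>
    (\<lambda>N. L1_norm m (\<lambda>x. f x - (\<Sum>i<N. c i * a i x))) \<longlonglongrightarrow> 0"

text \<open>
  Integrability of \<open>f\<close> is required explicitly because the Bochner integral of a non-integrable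
  function is 0 by convention, so that the limit alone would not express convergence in $L_1$.
\<close>

definition hardy_space :: "(nat \<Rightarrow> nat) \<Rightarrow> ((nat \<Rightarrow> nat) \<Rightarrow> complex) set" where
  "hardy_space m = {f. integrable (vilenkin_group m) f \<and> (\<exists>c a. atomic_decomposition m f c a)}"

definition hardy_norm :: "(nat \<Rightarrow> nat) \<Rightarrow> ((nat \<Rightarrow> nat) \<Rightarrow> complex) \<Rightarrow> real" where
  "hardy_norm m f = Inf {(\<Sum>i. norm (c i)) | c a. atomic_decomposition m f c a}"

end

(*
  a) Splitting n = a M_J + b with a < m_J, b < M_J gives
  K_n = (sum of the first a powers of w) K_{M_J} + w^a K_b for the Dirichlet kernels, where w is the
  J-th Rademacher factor. On Z_p the mean of the first term is at most 3 + 2 ln a, so by induction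
  the L1 norm of K_n is at most 3 + 7 ln n with constants independent of m, and the partial sums
  are bounded on L1 by this quantity.

  b) For p = m_J and a dyadic block [0, L) of Z_p, the wave exp(2 pi i x_J / L) restricted to
  x_0 = ... = x_{J-1} = 0, x_J < L is a multiple of an atom, and its coefficients at the
  frequencies a near p / L have modulus at least 1/2. For these a the partial sums of order
  a M_J + b have, after averaging over b, an L1 norm of size at least
  (ln M_J + ln (p / L)) / (4 pi) - C: the first logarithm comes from the average of the kernels K_b
  off the support of K_{M_J}, the second from the slow decay of a partial sum that is
  cut at a large coefficient. Every large n is of the order of M_J p / L for suitable J and L. The
  function f is a sum of geometrically weighted atoms of this kind.
*)

theory Submission
  imports Defs
begin

text \<open>Two difficulties shape b). The hypothesis on \<phi> only yields some orders n at which
  ln n / \<phi>_n is large and says nothing about where they lie. Hence an atom with large means is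
  needed for every large n, also when m_J is so large that n is far from both M_J and M_(J+1); a
  length L of order M_J m_J / n moves the large coefficients to blocks a M_J of the size of n.
  Moreover a single order cannot be relied on, since K_n has norm 1 for n = M_J. Only averages over
  orders are bounded below, and the means leave room for this: it suffices that the good pairs (a,
  b) fill a fixed share of all k up to n.

  The passage from L1 to H_1 in a) is the inequality between the two norms. The same upper bound
  returns in b): it limits the effect of all later atoms on the mean at the current order, and the
  ratio q of the weights is chosen small against the constants of both bounds. The earlier atoms,
  whose weights are larger, are dealt with by a choice of signs.\<close>

section \<open>Roots of unity and geometric sums\<close>

definition unity :: "nat \<Rightarrow> int \<Rightarrow> complex" where
  "unity p t = cis (2 * pi * of_int t / of_nat p)"

lemma unity_0 [simp]: "unity p 0 = 1"
  by (simp add: unity_def)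

lemma norm_unity [simp]: "norm (unity p t) = 1"
  by (simp add: unity_def)

lemma unity_add: "unity p (s + t) = unity p s * unity p t"
  by (simp add: unity_def cis_mult add_divide_distrib algebra_simps)

lemma cnj_unity: "cnj (unity p t) = unity p (- t)"
  by (simp add: unity_def cis_cnj)

lemma unity_power: "unity p t ^ a = unity p (int a * t)"
  unfolding unity_def by (subst Complex.DeMoivre) (simp add: mult.assoc mult.left_commute)

lemma unity_multiple: "p > 0 \<Longrightarrow> unity p (int p * t) = 1"
  using cis_multiple_2pi[of "of_int t"] by (simp add: unity_def mult.assoc)

lemma unity_power_order: "p > 0 \<Longrightarrow> unity p t ^ p = 1"
  by (simp add: unity_power unity_multiple)

lemma unity_period: "p > 0 \<Longrightarrow> unity p (t + int p * s) = unity p t"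
  by (simp add: unity_add unity_multiple)

lemma unity_mod: "p > 0 \<Longrightarrow> unity p (t mod int p) = unity p t"
  using unity_period[of p "t mod int p" "t div int p"] by simp

lemma norm_unity_diff_1: "norm (unity p t - 1) = 2 * \<bar>sin (pi * of_int t / of_nat p)\<bar>"
proof -
  have "norm (unity p t - 1) = norm (exp (\<i> * of_real (2 * pi * of_int t / of_nat p)) - 1)"
    by (simp add: unity_def cis_conv_exp)
  also have "\<dots> = 2 * \<bar>sin (2 * pi * of_int t / of_nat p / 2)\<bar>"
    by (rule dist_exp_i_1)
  finally show ?thesis
    by (simp add: mult.assoc)
qed

lemma norm_unity_diff_1_le: "norm (unity p t - 1) \<le> 2 * pi * of_int \<bar>t\<bar> / of_nat p"
proof -
  have "\<bar>sin (pi * of_int t / of_nat p)\<bar> \<le> \<bar>pi * of_int t / of_nat p\<bar>"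
    by (rule abs_sin_x_le_abs_x)
  then show ?thesis
    by (simp add: norm_unity_diff_1 abs_mult)
qed

text \<open>Concavity: on [0, pi/2] the sine lies above the chord joining its endpoint values 0 and
  1.\<close>

lemma jordan_sin_ge:
  assumes "0 \<le> x" "x \<le> pi / 2"
  shows "2 * x / pi \<le> sin (x::real)"
proof -
  have "concave_on {0..pi/2} sin"
  proof (rule f''_le0_imp_concave)
    show "convex {0..pi/2}" by (rule convex_real_interval)
    show "(sin has_real_derivative cos x) (at x)" for x by (rule DERIV_sin)
    show "(cos has_real_derivative - sin x) (at x)" for x by (rule DERIV_cos)
    show "x \<in> {0..pi/2} \<Longrightarrow> - sin x \<le> 0" for x by (auto intro!: sin_ge_zero)
  qed
  from concave_onD[OF this, of "2 * x / pi" 0 "pi / 2"] show ?thesis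
    using assms by (simp add: field_simps)
qed

text \<open>The half-angle pi t / p must stay in [0, pi/2], hence the restriction 2 t \<le> p; the
  other half of the circle is reached by reflecting t to p - t.\<close>

lemma norm_unity_diff_1_ge:
  assumes "0 \<le> t" "2 * t \<le> int p"
  shows "norm (unity p t - 1) \<ge> 4 * of_int t / of_nat p"
proof (cases "p = 0")
  case False
  have "2 * real_of_int t \<le> real p"
    using assms(2) by linarith
  then have "pi * of_int t / of_nat p \<le> pi / 2"
    using False by (simp add: field_simps)
  then have "2 * (pi * of_int t / of_nat p) / pi \<le> sin (pi * of_int t / of_nat p)"
    using assms by (intro jordan_sin_ge) auto
  then show ?thesis
    by (simp add: norm_unity_diff_1)
qed auto

lemma norm_unity_diff_1_minus: "norm (unity p (- t) - 1) = norm (unity p t - 1)"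
  by (simp add: norm_unity_diff_1)

lemma unity_neq_1:
  assumes "0 < t" "t < int p"
  shows "unity p t \<noteq> 1"
proof -
  have "norm (unity p t - 1) > 0"
  proof (cases "2 * t \<le> int p")
    case True
    then show ?thesis
      using norm_unity_diff_1_ge[of t p] assms
        divide_pos_pos[of "4 * real_of_int t" "real p"] by linarith
  next
    case False
    have "norm (unity p t - 1) = norm (unity p (int p - t) - 1)"
      using unity_period[of p "-t" 1] assms norm_unity_diff_1_minus[of p t] by simp
    moreover have "0 < 4 * real_of_int (int p - t) / real p"
      using assms by auto
    moreover have "4 * real_of_int (int p - t) / real p \<le> norm (unity p (int p - t) - 1)"
      using False assms by (intro norm_unity_diff_1_ge) auto
    ultimately show ?thesis by linarith
  qed
  then show ?thesis by auto
qed

lemma unity_neq_1':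
  assumes "x < p" "y < p" "x \<noteq> y"
  shows "unity p (int x - int y) \<noteq> 1"
proof (cases "y < x")
  case True
  then show ?thesis using unity_neq_1[of "int x - int y" p] assms by auto
next
  case False
  then have "unity p (int y - int x) \<noteq> 1"
    using unity_neq_1[of "int y - int x" p] assms by auto
  then show ?thesis
    using norm_unity_diff_1_minus[of p "int y - int x"] by auto
qed

lemma sum_unity_power:
  assumes "x < p" "y < p"
  shows "(\<Sum>a<p. unity p (int x - int y) ^ a) = (if x = y then of_nat p else 0)"
  using unity_neq_1'[of x p y] assms
  by (auto simp: geometric_sum unity_power_order)

text \<open>Counting terms gives the bound \<open>a\<close>, and the closed form gives 2 / |w - 1|,
  which the chord estimate controls through the smaller of \<open>d\<close> and
  \<open>p - d\<close>. Adding two minima instead of choosing one makes the bound symmetric under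
  reflection, so that one summation over \<open>d\<close> serves both.\<close>

lemma norm_geometric_unity_le:
  assumes "0 < d" "d < p"
  shows "norm (\<Sum>i<a. unity p (int d) ^ i) \<le>
    min (real a) (real p / (2 * real d)) + min (real a) (real p / (2 * real (p - d)))"
proof -
  let ?w = "unity p (int d)"
  have ne: "?w \<noteq> 1"
    using assms by (intro unity_neq_1) auto
  have 1: "norm (\<Sum>i<a. ?w ^ i) \<le> real a"
    by (rule order_trans[OF norm_sum]) (simp add: norm_power)
  have "norm (?w ^ a - 1) \<le> 2"
    using norm_triangle_ineq4[of "?w ^ a" 1] by (simp add: norm_power)
  then have 2: "norm (\<Sum>i<a. ?w ^ i) \<le> 2 / norm (?w - 1)"
    using ne by (simp add: geometric_sum norm_divide divide_right_mono)
  have n: "norm (?w - 1) > 0" using ne by simp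
  have 3: "norm (\<Sum>i<a. ?w ^ i) \<le> real p / (2 * real d)" if "2 * d \<le> p"
  proof -
    have "4 * real d / real p \<le> norm (?w - 1)"
      using norm_unity_diff_1_ge[of "int d" p] that by simp
    then have "2 / norm (?w - 1) \<le> 2 / (4 * real d / real p)"
      using assms n by (intro divide_left_mono mult_pos_pos) auto
    then show ?thesis using 2 by simp
  qed
  have 4: "norm (\<Sum>i<a. ?w ^ i) \<le> real p / (2 * real (p - d))" if "\<not> 2 * d \<le> p"
  proof -
    have "norm (?w - 1) = norm (unity p (int (p - d)) - 1)"
      using unity_period[of p "- int d" 1] assms norm_unity_diff_1_minus[of p d] by (simp add: of_nat_diff)
    moreover have "4 * real (p - d) / real p \<le> norm (unity p (int (p - d)) - 1)"
      using norm_unity_diff_1_ge[of "int (p - d)" p] that assms by simp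
    ultimately have "2 / norm (?w - 1) \<le> 2 / (4 * real (p - d) / real p)"
      using assms n by (intro divide_left_mono mult_pos_pos) auto
    then show ?thesis using 2 by simp
  qed
  have nn: "0 \<le> min (real a) (real p / (2 * real d))" "0 \<le> min (real a) (real p / (2 * real (p - d)))"
    by auto
  show ?thesis
  proof (cases "2 * d \<le> p")
    case True
    then show ?thesis
      by (rule add_increasing2[OF nn(2) min.boundedI[OF 1 3]])
  next
    case False
    then show ?thesis
      by (rule add_increasing[OF nn(1) min.boundedI[OF 1 4]])
  qed
qed

text \<open>Induction on \<open>a\<close> avoids splitting the range of \<open>d\<close>: passing
  from a to a + 1 raises only the terms with 2 a d < p, at most p / (2 a) of them and each by at
  most 1, and 1 / (2 a) \<le> 1 / (a + 1) \<le> ln (a + 1) - ln a.\<close>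

lemma sum_min_le_ln:
  assumes "a \<ge> 1" "p \<ge> 1"
  shows "(\<Sum>d=1..<p. min (real a) (real p / (2 * real d))) \<le> real p * (1 + ln (real a))"
  using assms(1)
proof (induction a rule: dec_induct)
  case base
  have "(\<Sum>d=1..<p. min (real 1) (real p / (2 * real d))) \<le> (\<Sum>d=1..<p. 1)"
    by (rule sum_mono) auto
  then show ?case using assms(2) by (simp add: of_nat_diff)
next
  case (step a)
  let ?D = "{d\<in>{1..<p}. real a < real p / (2 * real d)}"
  have "?D \<subseteq> {1..p div (2 * a)}"
  proof
    fix d assume d: "d \<in> ?D"
    then have "real a * (2 * real d) < real p"
      using less_divide_eq[of "real a" "real p" "2 * real d"] by auto
    then have "real (a * (2 * d)) < real p"
      by simp
    then have "a * (2 * d) < p"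
      by (simp only: of_nat_less_iff)
    then have "d * (2 * a) \<le> p" by (simp add: algebra_simps)
    then have "d \<le> p div (2 * a)"
      using step by (simp add: less_eq_div_iff_mult_less_eq)
    then show "d \<in> {1..p div (2 * a)}" using d by auto
  qed
  then have c: "card ?D \<le> p div (2 * a)"
    using card_mono[of "{1..p div (2 * a)}" ?D] by simp
  have cD: "real (card ?D) \<le> real p / (2 * real a)"
  proof -
    have "real (card ?D) \<le> real (p div (2 * a))"
      using c by (rule of_nat_mono)
    also have "\<dots> \<le> real p / real (2 * a)"
      by (rule of_nat_div_le_of_nat)
    finally show ?thesis by simp
  qed
  have l: "1 / (2 * real a) \<le> ln (real (Suc a)) - ln (real a)"
  proof -
    have "1 / (2 * real a) \<le> 1 - real a / real (Suc a)"
      using step by (simp add: field_simps)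
    also have "\<dots> \<le> - ln (real a / real (Suc a))"
      using ln_le_minus_one[of "real a / real (Suc a)"] step by simp
    finally show ?thesis using step by (simp add: ln_div)
  qed
  have "(\<Sum>d=1..<p. min (real (Suc a)) (real p / (2 * real d)))
      \<le> (\<Sum>d=1..<p. min (real a) (real p / (2 * real d)) + (if real a < real p / (2 * real d) then 1 else 0))"
    by (rule sum_mono) auto
  also have "\<dots> = (\<Sum>d=1..<p. min (real a) (real p / (2 * real d))) + real (card ?D)"
    by (simp add: sum.distrib sum.If_cases Int_def)
  also have "\<dots> \<le> real p * (1 + ln (real a)) + real p / (2 * real a)"
    using step.IH cD by (rule add_mono)
  also have "\<dots> \<le> real p * (1 + ln (real (Suc a)))"
    using mult_left_mono[OF l, of "real p"] by (simp add: algebra_simps)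
  finally show ?case .
qed

text \<open>Translation by \<open>y\<close> permutes Z_p, so the sum does not depend on
  \<open>y\<close>. The residue 0 contributes \<open>a\<close>, at most \<open>p\<close>, and each
  of the two minima contributes at most p (1 + ln a), which explains 3 + 2 ln a.\<close>

lemma sum_norm_geometric_unity_le:
  assumes "y < p" "a \<ge> 1" "a \<le> p"
  shows "(\<Sum>t<p. norm (\<Sum>i<a. unity p (int t - int y) ^ i)) \<le> real p * (3 + 2 * ln (real a))"
proof -
  let ?F = "\<lambda>d. norm (\<Sum>i<a. unity p d ^ i)"
  have p: "p > 0" using assms by simp
  have "(\<Sum>t<p. ?F (int t - int y)) = (\<Sum>d<p. ?F (int d))"
  proof (rule sum.reindex_bij_witness[where i = "\<lambda>d. (d + y) mod p"
        and j = "\<lambda>t. nat ((int t - int y) mod int p)"])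
    fix t assume t: "t \<in> {..<p}"
    have "int ((nat ((int t - int y) mod int p) + y) mod p) = int t"
      using p t by (simp add: zmod_int mod_simps)
    then show "(nat ((int t - int y) mod int p) + y) mod p = t"
      by (simp only: of_nat_eq_iff)
    show "nat ((int t - int y) mod int p) \<in> {..<p}"
      using p by (simp add: nat_less_iff)
    show "?F (int (nat ((int t - int y) mod int p))) = ?F (int t - int y)"
      using p by (simp add: unity_mod)
  next
    fix d assume d: "d \<in> {..<p}"
    have "(int ((d + y) mod p) - int y) mod int p = int d"
      using d by (simp add: zmod_int mod_simps)
    then show "nat ((int ((d + y) mod p) - int y) mod int p) = d" by simp
    show "(d + y) mod p \<in> {..<p}" using p by simp
  qed
  also have "\<dots> = real a + (\<Sum>d=1..<p. ?F (int d))"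
  proof -
    have "{..<p} = insert 0 {1..<p}"
      using p by auto
    then show ?thesis by simp
  qed
  also have "\<dots> \<le> real p + (\<Sum>d=1..<p. min (real a) (real p / (2 * real d)) + min (real a) (real p / (2 * real (p - d))))"
    using assms by (intro add_mono sum_mono norm_geometric_unity_le) auto
  also have "\<dots> = real p + ((\<Sum>d=1..<p. min (real a) (real p / (2 * real d)))
      + (\<Sum>d=1..<p. min (real a) (real p / (2 * real (p - d)))))"
    by (simp only: sum.distrib)
  also have "(\<Sum>d=1..<p. min (real a) (real p / (2 * real (p - d))))
      = (\<Sum>d=1..<p. min (real a) (real p / (2 * real d)))"
    by (rule sum.reindex_bij_witness[where i = "\<lambda>d. p - d" and j = "\<lambda>d. p - d"]) auto
  finally have "(\<Sum>t<p. ?F (int t - int y)) \<le> real p + ((\<Sum>d=1..<p. min (real a) (real p / (2 * real d)))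
      + (\<Sum>d=1..<p. min (real a) (real p / (2 * real d))))" .
  moreover have "(\<Sum>d=1..<p. min (real a) (real p / (2 * real d))) \<le> real p * (1 + ln (real a))"
    using assms p by (intro sum_min_le_ln) auto
  ultimately show ?thesis
    by (simp only: distrib_left)
qed

text \<open>Since \<open>\<bar>w ^ a * z - 1\<bar> \<ge> 1 - Re (z * w ^ a)\<close>, no choice of \<open>\<theta>\<close> can spoil the average over \<open>a\<close>.\<close>

lemma sum_norm_geometric_shift_ge:
  assumes "w ^ p = 1" "w \<noteq> (1::complex)" "norm w = 1"
  shows "(\<Sum>a<p. norm ((\<Sum>i<a. w ^ i) + \<theta> * w ^ a)) \<ge> real p / norm (w - 1)"
proof -
  \<comment> \<open>Summing the geometric series turns the expression into (w ^ a * z - 1) / (w -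
    1): \<open>\<theta>\<close> affects only the factor of w ^ a, and the sum of w ^ a over a full
    period is 0.\<close>
  define z where "z = 1 + \<theta> * (w - 1)"
  have s0: "(\<Sum>a<p. w ^ a) = 0"
    using assms by (simp add: geometric_sum)
  have n: "norm (w - 1) > 0" using assms by simp
  have "norm ((\<Sum>i<a. w ^ i) + \<theta> * w ^ a) \<ge> (1 - Re (z * w ^ a)) / norm (w - 1)" for a
  proof -
    have "(\<Sum>i<a. w ^ i) + \<theta> * w ^ a = (w ^ a * z - 1) / (w - 1)"
      using assms by (simp add: geometric_sum z_def field_simps)
    then have "norm ((\<Sum>i<a. w ^ i) + \<theta> * w ^ a) = norm (1 - w ^ a * z) / norm (w - 1)"
      by (simp add: norm_divide norm_minus_commute)
    moreover have "1 - Re (z * w ^ a) \<le> norm (1 - w ^ a * z)"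
      using complex_Re_le_cmod[of "1 - w ^ a * z"] by (simp add: mult.commute)
    ultimately show ?thesis by (simp add: divide_right_mono)
  qed
  then have "(\<Sum>a<p. norm ((\<Sum>i<a. w ^ i) + \<theta> * w ^ a)) \<ge> (\<Sum>a<p. (1 - Re (z * w ^ a)) / norm (w - 1))"
    by (rule sum_mono)
  also have "(\<Sum>a<p. (1 - Re (z * w ^ a)) / norm (w - 1)) = (real p - Re (z * (\<Sum>a<p. w ^ a))) / norm (w - 1)"
    by (simp add: sum_divide_distrib[symmetric] sum_subtractf sum_distrib_left)
  finally show ?thesis by (simp add: s0)
qed

lemma sum_inverse_ge_ln:
  assumes "1 \<le> k" "k \<le> n"
  shows "(\<Sum>x=k..<n. 1 / real x) \<ge> ln (real n / real k)"
  using assms(2)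
proof (induction n rule: dec_induct)
  case (step n)
  have "ln (real (Suc n) / real n) \<le> real (Suc n) / real n - 1"
    using step assms by (intro ln_le_minus_one) auto
  also have "\<dots> = 1 / real n" using step assms by (simp add: field_simps)
  finally show ?case using step assms by (simp add: ln_div)
qed (use assms in auto)

text \<open>The chord is at most the arc, so the sum dominates a harmonic sum; the points on the far
  half of the circle are underestimated, which costs only a constant factor.\<close>

lemma sum_inverse_norm_unity_ge:
  assumes "p \<ge> 1"
  shows "(\<Sum>x=1..<p. 1 / norm (unity p (int x) - 1)) \<ge> real p * ln (real p) / (2 * pi)"
proof -
  have "real p / (2 * pi) * ln (real p) \<le> real p / (2 * pi) * (\<Sum>x=1..<p. 1 / real x)"
    using sum_inverse_ge_ln[of 1 p] assms by (intro mult_left_mono) auto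
  also have "\<dots> = (\<Sum>x=1..<p. real p / (2 * pi) * (1 / real x))"
    by (simp only: sum_distrib_left)
  also have "\<dots> \<le> (\<Sum>x=1..<p. 1 / norm (unity p (int x) - 1))"
  proof (rule sum_mono)
    fix x assume x: "x \<in> {1..<p}"
    have "unity p (int x) \<noteq> 1" using x by (intro unity_neq_1) auto
    then have "1 / norm (unity p (int x) - 1) \<ge> 1 / (2 * pi * real x / real p)"
      using norm_unity_diff_1_le[of p "int x"] x by (intro divide_left_mono) auto
    then show "real p / (2 * pi) * (1 / real x) \<le> 1 / norm (unity p (int x) - 1)" by simp
  qed
  finally show ?thesis by simp
qed

lemma sum_lessThan_add_mult:
  fixes f :: "nat \<Rightarrow> 'b :: comm_monoid_add"
  shows "(\<Sum>j<a * N + b. f j) = (\<Sum>i<a. \<Sum>j<N. f (i * N + j)) + (\<Sum>j<b. f (a * N + j))"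
proof -
  have 1: "(\<Sum>j=c..<c + n. f j) = (\<Sum>j<n. f (c + j))" for c n
    by (rule sum.reindex_bij_witness[where i = "\<lambda>j. c + j" and j = "\<lambda>j. j - c"]) auto
  have "{..<a * N + b} = {..<a * N} \<union> {a * N..<a * N + b}"
    by auto
  then have "(\<Sum>j<a * N + b. f j) = (\<Sum>j<a * N. f j) + (\<Sum>j=a * N..<a * N + b. f j)"
    by (simp add: sum.union_disjoint ivl_disj_int_one)
  then show ?thesis
    by (simp add: sum.nat_group[symmetric] 1)
qed

locale vilenkin_system =
  fixes m :: "nat \<Rightarrow> nat"
  assumes m_ge_2: "2 \<le> m k"
begin

abbreviation G :: "(nat \<Rightarrow> nat) measure" where "G \<equiv> vilenkin_group m"
abbreviation M :: "nat \<Rightarrow> nat" where "M \<equiv> gen_power m"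

lemma m_pos [simp]: "0 < m k" and m_nonzero [simp]: "m k \<noteq> 0"
  using m_ge_2[of k] by auto

lemma M_pos [simp]: "0 < M k" and M_nonzero [simp]: "M k \<noteq> 0"
  using less_gen_power[of m k] m_ge_2 by auto

lemma ex_gen_power_bounds:
  assumes "n \<ge> 1"
  obtains J where "M J \<le> n" "n < M (Suc J)"
proof -
  have ex: "\<exists>k. n < M k"
    using less_gen_power[of m n] m_ge_2 by auto
  define K where "K = (LEAST k. n < M k)"
  have K: "n < M K" using LeastI_ex[OF ex] by (simp add: K_def)
  then have "K \<noteq> 0" using assms by (auto simp: gen_power_simps intro: Nat.gr0I)
  then obtain J where J: "K = Suc J" by (cases K) auto
  have "\<not> n < M J"
    using not_less_Least[of J "\<lambda>k. n < M k"] J by (simp add: K_def)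
  then show ?thesis using that[of J] K J by auto
qed

subsection \<open>The measure\<close>

lemma product_prob_space_uniform: "product_prob_space (\<lambda>k. uniform_count_measure {..<m k})"
proof -
  have "prob_space (uniform_count_measure {..<m k})" for k
    using m_pos[of k] by (intro prob_space_uniform_count_measure) (auto simp del: m_pos)
  then show "product_prob_space (\<lambda>k. uniform_count_measure {..<m k})"
    by (intro product_prob_space.intro product_prob_space_axioms.intro product_sigma_finite.intro
        prob_space_imp_sigma_finite)
qed

sublocale prob_space G
proof -
  interpret product_prob_space "\<lambda>k. uniform_count_measure {..<m k}" UNIV
    by (rule product_prob_space_uniform)
  show "prob_space G"
    unfolding vilenkin_group_def by (rule P.prob_space_axioms)
qed

lemma in_space_G: "x \<in> space G \<longleftrightarrow> (\<forall>k. x k < m k)"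
  by (auto simp: vilenkin_group_def space_PiM space_uniform_count_measure PiE_def Pi_def)

text \<open>Each factor carries its full power set, so every function of one coordinate is
  measurable.\<close>

lemma measurable_coordinate [measurable]: "(\<lambda>x. h (x k)) \<in> borel_measurable G"
proof (rule measurable_compose[where N = "uniform_count_measure {..<m k}"])
  show "(\<lambda>x. x k) \<in> measurable G (uniform_count_measure {..<m k})"
    unfolding vilenkin_group_def by (rule measurable_component_singleton) auto
  show "h \<in> borel_measurable (uniform_count_measure {..<m k})"
    by (auto simp: measurable_def space_uniform_count_measure sets_uniform_count_measure)
qed

text \<open>The first \<open>N\<close> coordinates are fixed and none is singled out, in contrast to
  \<open>cylinder\<close>; an induction on the level can then add one coordinate at a time.\<close>

definition cyl :: "(nat \<Rightarrow> nat) \<Rightarrow> nat \<Rightarrow> (nat \<Rightarrow> nat) set" where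
  "cyl v N = {x \<in> space G. \<forall>i<N. x i = v i}"

lemma cyl_0: "cyl v 0 = space G"
  by (simp add: cyl_def)

lemma cyl_Suc: "cyl v (Suc N) = {x \<in> cyl v N. x N = v N}"
  by (auto simp: cyl_def less_Suc_eq)

lemma measure_cyl:
  assumes "\<And>i. i < N \<Longrightarrow> v i < m i"
  shows sets_cyl: "cyl v N \<in> sets G" and "measure G (cyl v N) = 1 / M N"
proof -
  let ?\<mu> = "\<lambda>k. uniform_count_measure {..<m k}"
  interpret prod: product_prob_space ?\<mu> UNIV
    by (rule product_prob_space_uniform)
  have eq: "cyl v N = {x \<in> space (PiM UNIV ?\<mu>). \<forall>i\<in>{..<N}. x i \<in> {v i}}"
    by (auto simp: cyl_def vilenkin_group_def)
  have s: "{v i} \<in> sets (?\<mu> i)" if "i \<in> {..<N}" for i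
    using assms that by (auto simp: sets_uniform_count_measure)
  have s2: "{x \<in> space (PiM UNIV ?\<mu>). \<forall>i\<in>{..<N}. x i \<in> {v i}} = prod_emb UNIV ?\<mu> {..<N} (Pi\<^sub>E {..<N} (\<lambda>i. {v i}))"
    unfolding prod_emb_def by (auto simp: space_PiM Pi_iff)
  show "cyl v N \<in> sets G"
    unfolding eq s2 unfolding vilenkin_group_def using s by (intro sets_PiM_I) auto
  have "measure G (cyl v N) = (\<Prod>i\<in>{..<N}. measure (?\<mu> i) {v i})"
    unfolding eq s2 unfolding vilenkin_group_def using s by (intro prod.measure_PiM_emb) auto
  also have "\<dots> = (\<Prod>i<N. 1 / m i)"
    using assms by (intro prod.cong refl, subst measure_uniform_count_measure) auto
  also have "\<dots> = 1 / M N"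
    by (simp add: gen_power_def prod_dividef)
  finally show "measure G (cyl v N) = 1 / M N" .
qed

text \<open>The cylinder splits along coordinate \<open>J\<close> into m_J cylinders of measure 1 /
  M_(J+1), on each of which the integrand is constant. This is how integrals over the group become
  finite sums over Z_(m_J); scalar multiplication lets one statement serve both real norms and
  complex values.\<close>

lemma integral_cyl_coordinate:
  fixes h :: "nat \<Rightarrow> 'a :: {banach, second_countable_topology}"
  assumes "y \<in> space G"
  shows "integrable G (\<lambda>x. indicator (cyl y J) x *\<^sub>R h (x J))"
    and "(LINT x|G. indicator (cyl y J) x *\<^sub>R h (x J)) = (1 / real (M (Suc J))) *\<^sub>R (\<Sum>t<m J. h t)"
proof -
  let ?c = "\<lambda>t. cyl (y(J := t)) (Suc J)"
  have y: "y k < m k" for k using assms by (simp add: in_space_G)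
  have c: "?c t \<in> sets G" "measure G (?c t) = 1 / M (Suc J)" if "t < m J" for t
    using that y by (auto intro!: measure_cyl)
  have c': "?c t = {x \<in> cyl y J. x J = t}" for t
    by (auto simp: cyl_def less_Suc_eq)
  have eq: "indicator (cyl y J) x *\<^sub>R h (x J) = (\<Sum>t<m J. indicator (?c t) x *\<^sub>R h t)" if "x \<in> space G" for x
  proof -
    have "x J < m J" using that by (simp add: in_space_G)
    have "(\<Sum>t<m J. indicator (?c t) x *\<^sub>R h t) = (\<Sum>t<m J. if t = x J then indicator (cyl y J) x *\<^sub>R h (x J) else 0)"
      by (intro sum.cong refl) (auto simp: c' indicator_def)
    then show ?thesis using \<open>x J < m J\<close> by (simp add: sum.delta)
  qed
  have "has_bochner_integral G (\<lambda>x. \<Sum>t<m J. indicator (?c t) x *\<^sub>R h t)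
      (\<Sum>t<m J. measure G (?c t) *\<^sub>R h t)"
    using c by (intro has_bochner_integral_sum has_bochner_integral_indicator) (auto simp: emeasure_eq_measure)
  also have "(\<Sum>t<m J. measure G (?c t) *\<^sub>R h t) = (1 / real (M (Suc J))) *\<^sub>R (\<Sum>t<m J. h t)"
    unfolding scaleR_sum_right using c(2) by (intro sum.cong refl) auto
  finally have "has_bochner_integral G (\<lambda>x. indicator (cyl y J) x *\<^sub>R h (x J)) ((1 / real (M (Suc J))) *\<^sub>R (\<Sum>t<m J. h t))"
    by (subst has_bochner_integral_cong[OF refl eq refl])
  then show "integrable G (\<lambda>x. indicator (cyl y J) x *\<^sub>R h (x J))"
    and "(LINT x|G. indicator (cyl y J) x *\<^sub>R h (x J)) = (1 / real (M (Suc J))) *\<^sub>R (\<Sum>t<m J. h t)"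
    by (auto simp: has_bochner_integral_iff)
qed

subsection \<open>Characters and Dirichlet kernels\<close>

lemma rademacher_unity: "rademacher m k x = unity (m k) (int (x k))"
  by (simp add: rademacher_def unity_def cis_conv_exp mult_ac)

lemma vilenkin_eq_prod:
  assumes "n < M N"
  shows "vilenkin m n x = (\<Prod>k<N. rademacher m k x ^ digit m n k)"
proof -
  have "digit m n k = 0" if "k \<ge> N" for k
  proof -
    have "M N dvd M k"
      using that unfolding gen_power_def by (intro prod_dvd_prod_subset) auto
    then have "M N \<le> M k" by (rule dvd_imp_le) simp
    then show ?thesis using assms by (simp add: digit_def)
  qed
  then have "k < N" if "digit m n k \<noteq> 0" for k
    using that by (cases "N \<le> k") auto
  then have "{k. digit m n k \<noteq> 0} \<subseteq> {..<N}"
    by auto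
  then show ?thesis
    unfolding vilenkin_def by (intro prod.mono_neutral_left) auto
qed

lemma gen_power_dvd: "i \<le> j \<Longrightarrow> M i dvd M j"
  unfolding gen_power_def by (intro prod_dvd_prod_subset) auto

text \<open>The J-th digit of a M_J + b is \<open>a\<close>, and the lower digits are those of
  \<open>b\<close>.\<close>

lemma vilenkin_add:
  assumes "a < m J" "b < M J"
  shows "vilenkin m (a * M J + b) x = rademacher m J x ^ a * vilenkin m b x"
proof -
  have "a * M J + b < Suc a * M J" using assms by simp
  also have "\<dots> \<le> m J * M J" using assms by (intro mult_right_mono) auto
  finally have lt: "a * M J + b < M (Suc J)" by (simp add: gen_power_simps)
  have dJ: "digit m (a * M J + b) J = a"
    using assms by (simp add: digit_def)
  have dk: "digit m (a * M J + b) k = digit m b k" if "k < J" for k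
  proof -
    \<comment> \<open>For k < J the number M_J is a multiple of M_(k+1), so adding a M_J changes the
      quotient by M_k only by a multiple of m_k.\<close>
    have "M (Suc k) dvd M J"
      using that by (intro gen_power_dvd) simp
    then obtain c where "M J = M (Suc k) * c"
      by (rule dvdE)
    then have eq: "a * M J + b = b + M k * (m k * (c * a))"
      by (simp only: gen_power_simps mult_ac add_ac)
    have "(b + M k * (m k * (c * a))) div M k = m k * (c * a) + b div M k"
      by (rule div_mult_self2) simp
    then show ?thesis unfolding eq digit_def by simp
  qed
  have "(\<Prod>k<J. rademacher m k x ^ digit m (a * M J + b) k) = (\<Prod>k<J. rademacher m k x ^ digit m b k)"
    using dk by (intro prod.cong refl) auto
  then show ?thesis
    unfolding vilenkin_eq_prod[OF lt] vilenkin_eq_prod[OF assms(2)] prod.lessThan_Suc dJ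
    by (simp only: mult.commute)
qed

lemma norm_vilenkin [simp]: "norm (vilenkin m n x) = 1"
  by (simp add: vilenkin_def rademacher_unity prod_norm[symmetric] norm_power)

lemma measurable_vilenkin [measurable]: "vilenkin m n \<in> borel_measurable G"
proof -
  have "vilenkin m n = (\<lambda>x. \<Prod>k<n. unity (m k) (int (x k)) ^ digit m n k)"
    using less_gen_power[of m n] m_ge_2 by (auto simp: fun_eq_iff vilenkin_eq_prod rademacher_unity)
  moreover have "(\<lambda>x. \<Prod>k<n. unity (m k) (int (x k)) ^ digit m n k) \<in> borel_measurable G"
    by (rule borel_measurable_prod) (rule measurable_coordinate[where h = "\<lambda>t. unity (m k) (int t) ^ digit m n k" for k])
  ultimately show ?thesis
    by simp
qed

text \<open>This is the Dirichlet kernel at x - y. Keeping both points avoids arithmetic in the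
  group, since a character of a difference is a product with a conjugate.\<close>

definition kernel :: "nat \<Rightarrow> (nat \<Rightarrow> nat) \<Rightarrow> (nat \<Rightarrow> nat) \<Rightarrow> complex" where
  "kernel n x y = (\<Sum>j<n. vilenkin m j x * cnj (vilenkin m j y))"

lemma measurable_kernel_left [measurable]: "(\<lambda>x. kernel n x y) \<in> borel_measurable G"
  unfolding kernel_def
  by (intro borel_measurable_sum borel_measurable_times measurable_vilenkin borel_measurable_const)

lemma norm_kernel_le: "norm (kernel n x y) \<le> real n"
  unfolding kernel_def by (rule order_trans[OF norm_sum]) (simp add: norm_mult)

lemma kernel_add:
  assumes "a < m J" "b \<le> M J"
  shows "kernel (a * M J + b) x y =
    (\<Sum>i<a. unity (m J) (int (x J) - int (y J)) ^ i) * kernel (M J) x y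
      + unity (m J) (int (x J) - int (y J)) ^ a * kernel b x y"
proof -
  let ?w = "unity (m J) (int (x J) - int (y J))"
  have w: "rademacher m J x ^ i * cnj (rademacher m J y) ^ i = ?w ^ i" for i
    by (simp add: rademacher_unity cnj_unity power_mult_distrib[symmetric] unity_add[symmetric])
  have v: "vilenkin m (i * M J + j) x * cnj (vilenkin m (i * M J + j) y)
      = ?w ^ i * (vilenkin m j x * cnj (vilenkin m j y))" if "i < m J" "j < M J" for i j
    using that by (simp add: vilenkin_add w[symmetric] mult_ac)
  have "kernel (a * M J + b) x y = (\<Sum>i<a. \<Sum>j<M J. ?w ^ i * (vilenkin m j x * cnj (vilenkin m j y)))
      + (\<Sum>j<b. ?w ^ a * (vilenkin m j x * cnj (vilenkin m j y)))"
    unfolding kernel_def sum_lessThan_add_mult using assms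
    by (intro arg_cong2[where f = "(+)"] sum.cong refl v) auto
  then show ?thesis
    by (simp add: kernel_def sum_distrib_left[symmetric] sum_distrib_right[symmetric])
qed

text \<open>Passing from M_J to M_(J+1) multiplies the kernel by a complete character sum over
  Z_(m_J), which is m_J if x_J = y_J and 0 otherwise.\<close>

lemma kernel_gen_power:
  assumes "x \<in> space G" "y \<in> space G"
  shows "kernel (M J) x y = of_nat (M J) * indicator (cyl y J) x"
proof (induction J)
  case 0
  then show ?case
    using assms by (simp add: kernel_def gen_power_simps cyl_0 vilenkin_def digit_def)
next
  case (Suc J)
  let ?w = "unity (m J) (int (x J) - int (y J))"
  have "m J = Suc (m J - 1)" using m_pos[of J] by simp
  then have eq: "M (Suc J) = (m J - 1) * M J + M J" by (metis add.commute gen_power_simps(2) mult_Suc)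
  have "kernel (M (Suc J)) x y = ((\<Sum>i<m J - 1. ?w ^ i) + ?w ^ (m J - 1)) * kernel (M J) x y"
    unfolding eq by (subst kernel_add) (auto simp: distrib_right)
  also have "(\<Sum>i<m J - 1. ?w ^ i) + ?w ^ (m J - 1) = (\<Sum>i<m J. ?w ^ i)"
    using sum.lessThan_Suc[of "\<lambda>i. ?w ^ i" "m J - 1"] \<open>m J = Suc (m J - 1)\<close> by metis
  also have "\<dots> = (if x J = y J then of_nat (m J) else 0)"
    using assms by (intro sum_unity_power) (auto simp: in_space_G)
  finally show ?case
    using Suc by (auto simp: gen_power_simps cyl_Suc indicator_def)
qed

lemma integrable_kernel_left [simp]: "integrable G (\<lambda>x. kernel n x y)"
  by (rule integrable_const_bound[where B = "real n"]) (auto simp: norm_kernel_le)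

lemma norm_kernel_add:
  assumes "x \<in> space G" "y \<in> space G" "a < m J" "b \<le> M J"
  shows "norm (kernel (a * M J + b) x y) \<le>
    indicator (cyl y J) x *\<^sub>R (real (M J) * norm (\<Sum>i<a. unity (m J) (int (x J) - int (y J)) ^ i))
      + norm (kernel b x y)"
proof -
  let ?w = "unity (m J) (int (x J) - int (y J))"
  have "norm (kernel (a * M J + b) x y)
      \<le> norm ((\<Sum>i<a. ?w ^ i) * kernel (M J) x y) + norm (?w ^ a * kernel b x y)"
    unfolding kernel_add[OF assms(3,4)] by (rule norm_triangle_ineq)
  then show ?thesis
    using assms by (cases "x \<in> cyl y J") (simp_all add: kernel_gen_power norm_mult norm_power mult.commute)
qed

text \<open>Every nonzero digit costs 3 + 2 ln a, and the number of such digits can grow like ln n.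
  The loss is absorbed because (a + 1) b \<le> n: passing from \<open>n\<close> to \<open>b\<close>
  frees ln (a + 1), which is at least ln 2.\<close>

lemma integral_norm_kernel_le:
  assumes "y \<in> space G" "n \<ge> 1"
  shows "(LINT x|G. norm (kernel n x y)) \<le> 3 + 7 * ln (real n)"
  using assms(2)
proof (induction n rule: less_induct)
  case (less n)
  obtain J where J: "M J \<le> n" "n < M (Suc J)"
    using ex_gen_power_bounds[OF less.prems] by blast
  define a b where "a = n div M J" and "b = n mod M J"
  have n: "n = a * M J + b" by (simp only: a_def b_def div_mult_mod_eq)
  have a: "1 \<le> a" using J by (simp add: a_def Suc_leI div_greater_zero_iff)
  have am: "a < m J" using J by (simp add: a_def gen_power_simps less_mult_imp_div_less)
  have b: "b < M J" by (simp add: b_def)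
  let ?h = "\<lambda>t. real (M J) * norm (\<Sum>i<a. unity (m J) (int t - int (y J)) ^ i)"
  have "(LINT x|G. norm (kernel n x y))
      \<le> (LINT x|G. indicator (cyl y J) x *\<^sub>R ?h (x J) + norm (kernel b x y))"
    using integral_cyl_coordinate(1)[OF assms(1), of J ?h] norm_kernel_add[OF _ assms(1) am, of _ b] b
    by (intro integral_mono Bochner_Integration.integrable_add integrable_norm) (auto simp: n)
  also have "\<dots> = (LINT x|G. indicator (cyl y J) x *\<^sub>R ?h (x J)) + (LINT x|G. norm (kernel b x y))"
    using integral_cyl_coordinate(1)[OF assms(1), of J ?h] by (intro Bochner_Integration.integral_add) auto
  also have "(LINT x|G. indicator (cyl y J) x *\<^sub>R ?h (x J)) = (1 / real (M (Suc J))) * (\<Sum>t<m J. ?h t)"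
    using integral_cyl_coordinate(2)[OF assms(1), of J ?h] by simp
  also have "\<dots> = (\<Sum>t<m J. norm (\<Sum>i<a. unity (m J) (int t - int (y J)) ^ i)) / real (m J)"
    by (simp add: gen_power_simps sum_distrib_left[symmetric])
  also have "\<dots> \<le> 3 + 2 * ln (real a)"
    using sum_norm_geometric_unity_le[of "y J" "m J" a] assms(1) a am
    by (simp add: in_space_G divide_le_eq mult.commute)
  finally have main: "(LINT x|G. norm (kernel n x y)) \<le> 3 + 2 * ln (real a) + (LINT x|G. norm (kernel b x y))"
    by simp
  have la: "0 \<le> ln (real a)" using a by simp
  show ?case
  proof (cases "b = 0")
    case True
    have "ln (real a) \<le> ln (real n)"
    proof (rule ln_mono)
      show "real a \<le> real n"
        unfolding a_def of_nat_le_iff by (rule div_le_dividend)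
    qed (use a in auto)
    then show ?thesis using main la True by (simp add: kernel_def)
  next
    case False
    have "b < n" using n a b by (cases a) auto
    then have IH: "(LINT x|G. norm (kernel b x y)) \<le> 3 + 7 * ln (real b)"
      using False by (intro less.IH) auto
    have "(a + 1) * b \<le> n"
      using b unfolding n by (simp add: mult_le_mono2)
    then have "real (a + 1) * real b \<le> real n" by (simp only: of_nat_le_iff flip: of_nat_mult)
    then have "ln (real (a + 1) * real b) \<le> ln (real n)"
      using False by (intro ln_mono mult_pos_pos) auto
    then have 1: "ln (real (a + 1)) + ln (real b) \<le> ln (real n)"
      using False by (subst (asm) ln_mult) auto
    have "ln 2 \<le> ln (real (a + 1))" "ln (real a) \<le> ln (real (a + 1))"
      using a by (auto intro!: ln_mono)
    \<comment> \<open>Origin of the constant 7: ln (a + 1) \<ge> 2/3 gives 3 \<le> 9/2 ln (a + 1),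
      and 2 + 9/2 < 7.\<close>
    then have "3 + 2 * ln (real a) \<le> 7 * ln (real (a + 1))"
      using ln2_ge_two_thirds by linarith
    then show ?thesis using main IH 1 by linarith
  qed
qed

section \<open>Partial sums as integral operators on L1\<close>

lemma measurable_cnj_vilenkin: "(\<lambda>x. cnj (vilenkin m n x)) \<in> borel_measurable G"
  by (rule measurable_compose[OF measurable_vilenkin])
    (intro borel_measurable_continuous_onI continuous_intros)

lemma partial_sum_eq_integral_kernel:
  assumes "integrable G f"
  shows "partial_sum m k f x = (LINT y|G. f y * kernel k x y)"
proof -
  have int: "integrable G (\<lambda>y. f y * cnj (vilenkin m j y))" for j
    by (rule Bochner_Integration.integrable_bound[OF assms])
      (use assms in \<open>auto simp: norm_mult intro!: borel_measurable_times measurable_cnj_vilenkin\<close>)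
  have "(LINT y|G. f y * kernel k x y) = (LINT y|G. (\<Sum>j<k. (f y * cnj (vilenkin m j y)) * vilenkin m j x))"
    by (simp add: kernel_def sum_distrib_left mult_ac)
  also have "\<dots> = (\<Sum>j<k. LINT y|G. (f y * cnj (vilenkin m j y)) * vilenkin m j x)"
    using int by (intro Bochner_Integration.integral_sum integrable_mult_left) auto
  finally show ?thesis
    by (simp add: partial_sum_def fourier_coeff_def)
qed

lemma measurable_partial_sum [measurable]: "partial_sum m k f \<in> borel_measurable G"
  unfolding partial_sum_def[abs_def]
  by (intro borel_measurable_sum borel_measurable_times measurable_vilenkin borel_measurable_const)

lemma integrable_partial_sum [simp]: "integrable G (partial_sum m k f)"
proof (rule integrable_const_bound[where B = "\<Sum>j<k. norm (fourier_coeff m f j)"])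
  show "AE x in G. norm (partial_sum m k f x) \<le> (\<Sum>j<k. norm (fourier_coeff m f j))"
    unfolding partial_sum_def by (intro AE_I2 order_trans[OF norm_sum]) (simp add: norm_mult)
qed simp

lemma measurable_kernel_pair: "(\<lambda>z. kernel n (fst z) (snd z)) \<in> borel_measurable (G \<Otimes>\<^sub>M G)"
proof -
  have "(\<lambda>z. vilenkin m j (fst z)) \<in> borel_measurable (G \<Otimes>\<^sub>M G)"
       "(\<lambda>z. cnj (vilenkin m j (snd z))) \<in> borel_measurable (G \<Otimes>\<^sub>M G)" for j
    by (rule measurable_compose[OF measurable_fst measurable_vilenkin],
        rule measurable_compose[OF measurable_snd measurable_cnj_vilenkin])
  then show ?thesis
    unfolding kernel_def
    by (intro borel_measurable_sum borel_measurable_times)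
qed

text \<open>Insert absolute values in the kernel representation, exchange the integrals, and use the
  kernel bound in \<open>x\<close> uniformly in \<open>y\<close>. With nonnegative integrals the
  exchange follows from measurability alone.\<close>

lemma L1_norm_partial_sum_le:
  assumes f: "integrable G f" and k: "k \<ge> 1"
  shows "L1_norm m (partial_sum m k f) \<le> (3 + 7 * ln (real k)) * L1_norm m f"
proof -
  interpret P: pair_sigma_finite G G ..
  define B where "B = 3 + 7 * ln (real k)"
  have B: "B \<ge> 0" using k by (simp add: B_def)
  have fm: "f \<in> borel_measurable G" using f by auto
  have intK: "integrable G (\<lambda>y. f y * kernel k x y)" for x
  proof -
    have "(\<lambda>y. kernel k x y) \<in> borel_measurable G"
      unfolding kernel_def
      by (intro borel_measurable_sum borel_measurable_times measurable_cnj_vilenkin borel_measurable_const)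
    then have "(\<lambda>y. f y * kernel k x y) \<in> borel_measurable G"
      by (intro borel_measurable_times fm)
    moreover have "norm (f y * kernel k x y) \<le> norm (of_nat k * f y)" for y
      using mult_right_mono[OF norm_kernel_le[of k x y], of "norm (f y)"]
      by (simp add: norm_mult mult.commute)
    ultimately show ?thesis
      using Bochner_Integration.integrable_bound[OF integrable_mult_right[OF f, of "of_nat k"]] by blast
  qed
  have "ennreal (L1_norm m (partial_sum m k f)) = (\<integral>\<^sup>+x. norm (partial_sum m k f x) \<partial>G)"
    unfolding L1_norm_def by (rule nn_integral_eq_integral[symmetric]) auto
  also have "\<dots> \<le> (\<integral>\<^sup>+x. (\<integral>\<^sup>+y. norm (f y * kernel k x y) \<partial>G) \<partial>G)"
    unfolding partial_sum_eq_integral_kernel[OF f]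
    by (intro nn_integral_mono integral_norm_bound_ennreal intK)
  also have "\<dots> = (\<integral>\<^sup>+y. (\<integral>\<^sup>+x. norm (f y * kernel k x y) \<partial>G) \<partial>G)"
  proof (rule P.Fubini'[symmetric])
    have "(\<lambda>z. f (snd z) * kernel k (fst z) (snd z)) \<in> borel_measurable (G \<Otimes>\<^sub>M G)"
      by (intro borel_measurable_times measurable_kernel_pair measurable_compose[OF measurable_snd fm])
    then show "(\<lambda>(x, y). ennreal (norm (f y * kernel k x y))) \<in> borel_measurable (G \<Otimes>\<^sub>M G)"
      by (simp add: case_prod_beta)
  qed
  also have "\<dots> \<le> (\<integral>\<^sup>+y. ennreal B * ennreal (norm (f y)) \<partial>G)"
  proof (rule nn_integral_mono)
    fix y assume y: "y \<in> space G"
    have "(\<integral>\<^sup>+x. norm (f y * kernel k x y) \<partial>G) = ennreal (LINT x|G. norm (f y * kernel k x y))"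
      by (intro nn_integral_eq_integral) auto
    also have "(LINT x|G. norm (f y * kernel k x y)) = norm (f y) * (LINT x|G. norm (kernel k x y))"
      by (simp add: norm_mult)
    also have "\<dots> \<le> norm (f y) * B"
      using integral_norm_kernel_le[OF y k] by (intro mult_left_mono) (auto simp: B_def)
    finally show "(\<integral>\<^sup>+x. norm (f y * kernel k x y) \<partial>G) \<le> ennreal B * ennreal (norm (f y))"
      using B by (simp add: ennreal_mult[symmetric] ennreal_leI mult.commute)
  qed
  also have "\<dots> = ennreal B * ennreal (L1_norm m f)"
    unfolding L1_norm_def using fm f
    by (subst nn_integral_cmult) (auto intro!: arg_cong2[where f = "(*)"] nn_integral_eq_integral)
  also have "\<dots> = ennreal (B * L1_norm m f)"
    using B by (simp add: ennreal_mult L1_norm_def)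
  finally show ?thesis
    using B by (simp add: B_def L1_norm_def)
qed

subsection \<open>Atoms and the Hardy norm\<close>

lemma dyadic_blocks_subset: "U \<in> dyadic_blocks N \<Longrightarrow> U \<subseteq> {0..<N}"
  by (induction rule: dyadic_blocks.induct) (auto simp: subset_iff)

lemma cylinder_eq: "cylinder m n x k = cyl (x(n := k)) (Suc n)"
  by (auto simp: cylinder_def cyl_def less_Suc_eq)

lemma sets_vilenkin_interval:
  assumes "vilenkin_interval m I"
  shows "I \<in> sets G"
proof -
  obtain x n U where x: "x \<in> space G" "U \<in> dyadic_blocks (m n)" "I = (\<Union>k\<in>U. cylinder m n x k)"
    using assms unfolding vilenkin_interval_def by blast
  have "cylinder m n x k \<in> sets G" if "k \<in> U" for k
    unfolding cylinder_eq using x(1) dyadic_blocks_subset[OF x(2)] that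
    by (intro sets_cyl) (auto simp: in_space_G)
  moreover have "finite U"
    using dyadic_blocks_subset[OF x(2)] finite_subset by blast
  ultimately show ?thesis unfolding x(3) by (intro sets.finite_UN) auto
qed

lemma integrable_atom:
  assumes "atom m a"
  shows "integrable G a"
  using assms unfolding atom_def by (auto intro: integrable_const_bound)

lemma L1_norm_atom_le:
  assumes "atom m a"
  shows "L1_norm m a \<le> 1"
proof -
  have int: "integrable G (\<lambda>x. norm (a x))"
    using integrable_atom[OF assms] by simp
  consider "AE x in G. a x = 1"
    | I where "vilenkin_interval m I" "AE x in G. x \<notin> I \<longrightarrow> a x = 0"
        "AE x in G. norm (a x) \<le> 1 / measure G I"
    using assms unfolding atom_def by blast
  then show ?thesis
  proof cases
    case 1
    then have "(LINT x|G. norm (a x)) \<le> (LINT x|G. 1)"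
      using int by (intro integral_mono_AE) auto
    then show ?thesis by (simp add: L1_norm_def prob_space)
  next
    case 2
    have I: "I \<in> sets G" using 2(1) by (rule sets_vilenkin_interval)
    have "(LINT x|G. norm (a x)) \<le> (LINT x|G. indicator I x * (1 / measure G I))"
    proof (rule integral_mono_AE[OF int])
      show "integrable G (\<lambda>x. indicator I x * (1 / measure G I))"
        using I by (intro integrable_mult_left) (auto simp: less_top[symmetric])
      show "AE x in G. norm (a x) \<le> indicator I x * (1 / measure G I)"
        using 2(2,3) by eventually_elim (auto simp: indicator_def)
    qed
    also have "\<dots> = measure G I * (1 / measure G I)"
      using I by (simp add: less_top[symmetric])
    also have "\<dots> \<le> 1" by simp
    finally show ?thesis by (simp add: L1_norm_def)
  qed
qed

lemma L1_norm_nonneg: "L1_norm m f \<ge> 0"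
  by (simp add: L1_norm_def)

lemma L1_norm_add_le:
  assumes "integrable G f" "integrable G g"
  shows "L1_norm m (\<lambda>x. f x + g x) \<le> L1_norm m f + L1_norm m g"
proof -
  have "L1_norm m (\<lambda>x. f x + g x) \<le> (LINT x|G. norm (f x) + norm (g x))"
    unfolding L1_norm_def using assms by (intro integral_mono norm_triangle_ineq) auto
  then show ?thesis using assms by (simp add: L1_norm_def)
qed

lemma L1_norm_cmult: "L1_norm m (\<lambda>x. c * f x) = norm c * L1_norm m f"
  by (simp add: L1_norm_def norm_mult)

lemma L1_norm_sum_le:
  assumes "\<And>i. i \<in> A \<Longrightarrow> integrable G (f i)"
  shows "L1_norm m (\<lambda>x. \<Sum>i\<in>A. f i x) \<le> (\<Sum>i\<in>A. L1_norm m (f i))"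
  using assms
proof (induction A rule: infinite_finite_induct)
  case (insert i A)
  have "L1_norm m (\<lambda>x. f i x + (\<Sum>i\<in>A. f i x)) \<le> L1_norm m (f i) + L1_norm m (\<lambda>x. \<Sum>i\<in>A. f i x)"
    using insert.prems by (intro L1_norm_add_le Bochner_Integration.integrable_sum) auto
  then show ?case using insert by force
qed (auto simp: L1_norm_def)

text \<open>The partial sums of the decomposition have norm at most the full sum of |c_i|, since
  atoms have L1 norm at most 1, and the remainder vanishes in the limit.\<close>

lemma L1_norm_le_atomic:
  assumes f: "integrable G f" and dec: "atomic_decomposition m f c a"
  shows "L1_norm m f \<le> (\<Sum>i. norm (c i))"
proof -
  let ?s = "\<lambda>N x. \<Sum>i<N. c i * a i x"
  have a: "atom m (a i)" for i
    using dec unfolding atomic_decomposition_def by auto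
  have c: "summable (\<lambda>i. norm (c i))"
    and conv: "(\<lambda>N. L1_norm m (\<lambda>x. f x - ?s N x)) \<longlonglongrightarrow> 0"
    using dec unfolding atomic_decomposition_def by auto
  have inta: "integrable G (\<lambda>x. c i * a i x)" for i
    using integrable_atom[OF a] by simp
  have ints: "integrable G (?s N)" for N
    using inta by (intro Bochner_Integration.integrable_sum) auto
  have "L1_norm m f \<le> L1_norm m (\<lambda>x. f x - ?s N x) + (\<Sum>i. norm (c i))" for N
  proof -
    have "L1_norm m (\<lambda>x. (f x - ?s N x) + ?s N x) \<le> L1_norm m (\<lambda>x. f x - ?s N x) + L1_norm m (?s N)"
      using f ints by (intro L1_norm_add_le Bochner_Integration.integrable_diff) auto
    moreover have "L1_norm m (?s N) \<le> (\<Sum>i<N. norm (c i) * 1)"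
      using inta L1_norm_atom_le[OF a]
      by (intro order_trans[OF L1_norm_sum_le] sum_mono) (auto simp: L1_norm_cmult intro!: mult_left_le)
    moreover have "(\<Sum>i<N. norm (c i)) \<le> (\<Sum>i. norm (c i))"
      using c by (intro sum_le_suminf) auto
    ultimately show ?thesis by simp
  qed
  then show ?thesis
    using tendsto_add[OF conv tendsto_const[of "\<Sum>i. norm (c i)"]]
    by (intro tendsto_lowerbound[where F = sequentially and f = "\<lambda>N. L1_norm m (\<lambda>x. f x - ?s N x) + (\<Sum>i. norm (c i))"])
      auto
qed

text \<open>Membership in \<open>hardy_space\<close> makes the set under the infimum nonempty,
  without which a lower bound of the set would not pass to its real infimum.\<close>

lemma L1_norm_le_hardy_norm:
  assumes "f \<in> hardy_space m"
  shows "L1_norm m f \<le> hardy_norm m f"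
  unfolding hardy_norm_def
  using assms L1_norm_le_atomic unfolding hardy_space_def by (intro cInf_greatest) auto

end

subsection \<open>Lower bounds on a cyclic group\<close>

lemma sum_inverse_squares_le:
  assumes "2 \<le> k" "k \<le> n"
  shows "(\<Sum>t=k..<n. 1 / (real t)\<^sup>2) \<le> 1 / (real k - 1) - 1 / (real n - 1)"
  using assms(2)
proof (induction n rule: dec_induct)
  case (step n)
  have n: "real n \<ge> 2" using step assms by simp
  have "1 / (real n)\<^sup>2 \<le> 1 / (real n * (real n - 1))"
    using n by (intro divide_left_mono) (auto simp: power2_eq_square)
  also have "\<dots> = 1 / (real n - 1) - 1 / real n"
    using n by (simp add: divide_simps)
  finally show ?case using step by simp
qed simp

text \<open>The Fourier coefficient at \<open>a\<close>, for the normalized counting measure on Z_p,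
  of the wave exp(2 pi i y / L) on [0, L) scaled to height p / L.\<close>

definition wave_coeff :: "nat \<Rightarrow> nat \<Rightarrow> nat \<Rightarrow> complex" where
  "wave_coeff p L a = (\<Sum>y<L. unity L (int y) * unity p (- (int a * int y))) / of_nat L"

lemma norm_wave_coeff_le: "norm (wave_coeff p L a) \<le> 1"
proof -
  have "norm (\<Sum>y<L. unity L (int y) * unity p (- (int a * int y))) \<le> real L"
    by (rule order_trans[OF norm_sum]) (simp add: norm_mult)
  then show ?thesis
    by (simp add: wave_coeff_def norm_divide divide_le_eq)
qed

text \<open>The phases combine to 2 pi (y / L) (p - a L) / p. The condition 5/6 \<le> a L / p \<le>
  1 keeps them in [0, pi/3], where the cosine is at least 1/2, so the terms cannot cancel.\<close>

lemma norm_wave_coeff_ge: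
  assumes "0 < L" "0 < p" "5 * p \<le> 6 * (a * L)" "a * L \<le> p"
  shows "norm (wave_coeff p L a) \<ge> 1 / 2"
proof -
  have Re_ge: "Re (unity L (int y) * unity p (- (int a * int y))) \<ge> 1 / 2" if "y < L" for y
  proof -
    define s where "s = 2 * pi * (real y / real L) * ((real p - real a * real L) / real p)"
    have eq: "2 * pi * of_int (int y) / of_nat L + 2 * pi * of_int (- (int a * int y)) / of_nat p = s"
      using assms(1,2) by (simp add: s_def field_simps)
    have "real (a * L) \<le> real p" "real (5 * p) \<le> real (6 * (a * L))"
      using assms(3,4) by (simp_all only: of_nat_le_iff)
    then have aL: "real a * real L \<le> real p" "5 * real p \<le> 6 * (real a * real L)"
      by simp_all
    have "s \<ge> 0"
      using aL by (simp add: s_def)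
    have "(real p - real a * real L) / real p \<le> 1 / 6"
      using aL assms by (simp add: field_simps)
    moreover have "real y / real L \<le> 1" "0 \<le> (real p - real a * real L) / real p"
      using that aL by auto
    ultimately have "(real y / real L) * ((real p - real a * real L) / real p) \<le> 1 * (1 / 6)"
      by (intro mult_mono) auto
    then have "2 * pi * ((real y / real L) * ((real p - real a * real L) / real p)) \<le> 2 * pi * (1 * (1 / 6))"
      by (intro mult_left_mono) auto
    then have "s \<le> pi / 3"
      by (simp add: s_def mult.assoc)
    then have "cos (pi / 3) \<le> cos s"
      using \<open>s \<ge> 0\<close> by (intro cos_monotone_0_pi_le) auto
    then show ?thesis
      unfolding unity_def cis_mult eq by (simp add: cos_60)
  qed
  have "real L * (1 / 2) = (\<Sum>y<L. 1 / 2)"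
    by simp
  also have "\<dots> \<le> (\<Sum>y<L. Re (unity L (int y) * unity p (- (int a * int y))))"
    using Re_ge by (intro sum_mono) auto
  also have "\<dots> \<le> norm (\<Sum>y<L. unity L (int y) * unity p (- (int a * int y)))"
    unfolding Re_sum[symmetric] by (rule complex_Re_le_cmod)
  finally show ?thesis
    using assms(1) by (simp add: wave_coeff_def norm_divide field_simps)
qed

definition wave_sum :: "nat \<Rightarrow> nat \<Rightarrow> nat \<Rightarrow> nat \<Rightarrow> complex" where
  "wave_sum p L a t = (\<Sum>i<a. wave_coeff p L i * unity p (int t) ^ i)"

text \<open>Convolution form: the partial sum on Z_p is the wave averaged against the Dirichlet
  kernel of Z_p.\<close>

lemma wave_sum_eq:
  "wave_sum p L a t = (\<Sum>y<L. unity L (int y) * (\<Sum>i<a. unity p (int t - int y) ^ i)) / of_nat L"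
proof -
  have eq: "unity p (- (int i * int y)) * unity p (int t) ^ i = unity p (int t - int y) ^ i" for i y
    by (simp add: unity_power unity_add[symmetric] algebra_simps)
  have "wave_sum p L a t = (\<Sum>i<a. \<Sum>y<L. unity L (int y) * (unity p (- (int i * int y)) * unity p (int t) ^ i)) / of_nat L"
    unfolding wave_sum_def wave_coeff_def sum_divide_distrib sum_distrib_right
    by (simp add: mult.assoc sum_divide_distrib)
  also have "\<dots> = (\<Sum>y<L. \<Sum>i<a. unity L (int y) * unity p (int t - int y) ^ i) / of_nat L"
    unfolding eq by (subst sum.swap) (rule refl)
  finally show ?thesis by (simp only: sum_distrib_left)
qed

text \<open>Here L \<ge> 2 matters: for L = 1 the wave is the constant 1. The identity serves twice,
  as the mean value condition of the atom and as the cancellation in its partial sums.\<close>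

lemma sum_unity_eq_0:
  assumes "2 \<le> L"
  shows "(\<Sum>y<L. unity L (int y)) = 0"
proof -
  have "(\<Sum>y<L. unity L (int y)) = (\<Sum>y<L. unity L 1 ^ y)"
    by (simp add: unity_power)
  also have "\<dots> = 0"
    using assms unity_neq_1[of 1 L] by (simp add: geometric_sum unity_power_order)
  finally show ?thesis .
qed

text \<open>
  Away from the support the kernel \<open>1 / (unity p (t - y) - 1)\<close> is close to \<open>1 / (unity p t - 1)\<close>;
  the cancellation of the wave leaves only the term with the single coefficient \<open>wave_coeff p L a\<close>.
\<close>

lemma norm_wave_sum_ge:
  assumes "2 \<le> L" "2 * L \<le> t" "2 * t \<le> p"
  shows "norm (wave_sum p L a t) \<ge>
    norm (wave_coeff p L a) * real p / (2 * pi) * (1 / real t) - pi * real L * real p / 2 * (1 / (real t)\<^sup>2)"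
proof -
  define w where "w = unity p (int t)"
  define v where "v = (\<lambda>y. unity p (int t - int y))"
  \<comment> \<open>The exact error of replacing 1 / (v y - 1) by 1 / (w - 1) in the geometric
    sum.\<close>
  define E where "E = (\<lambda>y. (v y ^ a - 1) * (w - v y) / ((v y - 1) * (w - 1)))"
  have t: "0 < t" "t < p" using assms by auto
  have p: "0 < p" using t by simp
  have w1: "w \<noteq> 1" unfolding w_def using t by (intro unity_neq_1) auto
  have nw: "norm (w - 1) \<ge> 4 * real t / real p"
    using norm_unity_diff_1_ge[of "int t" p] assms by (simp add: w_def)
  have v1: "v y \<noteq> 1" if "y < L" for y
    unfolding v_def using that assms by (intro unity_neq_1) auto
  \<comment> \<open>Since y < L \<le> t / 2, the distance t - y is still at least t / 2.\<close>
  have nv: "norm (v y - 1) \<ge> 2 * real t / real p" if "y < L" for y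
  proof -
    have "2 * real t / real p \<le> 4 * real_of_int (int t - int y) / real p"
      using that assms by (intro divide_right_mono) auto
    also have "\<dots> \<le> norm (v y - 1)"
      unfolding v_def using that assms by (intro norm_unity_diff_1_ge) auto
    finally show ?thesis .
  qed
  have nwv: "norm (w - v y) \<le> 2 * pi * real L / real p" if "y < L" for y
  proof -
    have "w = v y * unity p (int y)"
      by (simp add: w_def v_def unity_add[symmetric])
    then have "w - v y = v y * (unity p (int y) - 1)"
      by (simp add: algebra_simps)
    then have "norm (w - v y) = norm (unity p (int y) - 1)"
      by (simp add: norm_mult v_def)
    also have "\<dots> \<le> 2 * pi * real y / real p"
      using norm_unity_diff_1_le[of p "int y"] by simp
    also have "\<dots> \<le> 2 * pi * real L / real p"
      using that by (intro divide_right_mono mult_left_mono) auto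
    finally show ?thesis .
  qed
  have nE: "norm (E y) \<le> pi * real L * real p / 2 * (1 / (real t)\<^sup>2)" if "y < L" for y
  proof -
    have "norm (v y ^ a - 1) \<le> 2"
      using norm_triangle_ineq4[of "v y ^ a" 1] by (simp add: norm_power v_def)
    then have "norm (E y) \<le> 2 * (2 * pi * real L / real p) / ((2 * real t / real p) * (4 * real t / real p))"
      unfolding E_def norm_divide norm_mult using nwv[OF that] nv[OF that] nw t p
      by (intro frac_le mult_mono mult_pos_pos divide_pos_pos mult_nonneg_nonneg) auto
    also have "\<dots> = pi * real L * real p / 2 * (1 / (real t)\<^sup>2)"
      using t p by (simp add: field_simps power2_eq_square)
    finally show ?thesis .
  qed
  have split: "(\<Sum>i<a. v y ^ i) = (v y ^ a - 1) / (w - 1) + E y" if "y < L" for y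
  proof -
    have "z / p = z / q + z * (q - p) / (p * q)" if "p \<noteq> 0" "q \<noteq> 0" for z p q :: complex
      using that by (simp add: field_simps)
    from this[of "v y - 1" "w - 1" "v y ^ a - 1"] show ?thesis
      using v1[OF that] w1 by (simp add: geometric_sum E_def)
  qed
  have va: "v y ^ a = w ^ a * unity p (- (int a * int y))" for y
    by (simp add: v_def w_def unity_power unity_add[symmetric] algebra_simps)
  \<comment> \<open>The wave annihilates the constant -1, while v y ^ a separates into w ^ a and the
    phase that occurs in \<open>wave_coeff\<close>.\<close>
  have "(\<Sum>y<L. unity L (int y) * (v y ^ a - 1))
      = (\<Sum>y<L. w ^ a * (unity L (int y) * unity p (- (int a * int y)))) - (\<Sum>y<L. unity L (int y))"
    unfolding sum_subtractf[symmetric] va by (intro sum.cong refl) (simp add: algebra_simps)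
  also have "\<dots> = w ^ a * (of_nat L * wave_coeff p L a)"
    using assms by (simp add: sum_unity_eq_0 wave_coeff_def sum_distrib_left[symmetric])
  finally have main: "(\<Sum>y<L. unity L (int y) * (v y ^ a - 1)) = w ^ a * (of_nat L * wave_coeff p L a)" .
  have "(\<Sum>y<L. unity L (int y) * (\<Sum>i<a. v y ^ i))
      = (\<Sum>y<L. unity L (int y) * (v y ^ a - 1) / (w - 1) + unity L (int y) * E y)"
    using split by (intro sum.cong refl) (simp add: algebra_simps)
  also have "\<dots> = (\<Sum>y<L. unity L (int y) * (v y ^ a - 1)) / (w - 1) + (\<Sum>y<L. unity L (int y) * E y)"
    by (simp add: sum.distrib sum_divide_distrib)
  finally have eqS: "(\<Sum>y<L. unity L (int y) * (\<Sum>i<a. v y ^ i))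
      = (\<Sum>y<L. unity L (int y) * (v y ^ a - 1)) / (w - 1) + (\<Sum>y<L. unity L (int y) * E y)" .
  have vS: "wave_sum p L a t = (\<Sum>y<L. unity L (int y) * (\<Sum>i<a. v y ^ i)) / of_nat L"
    by (simp add: wave_sum_eq v_def)
  have S: "wave_sum p L a t = w ^ a * wave_coeff p L a / (w - 1) + (\<Sum>y<L. unity L (int y) * E y) / of_nat L"
    using assms unfolding vS eqS main by (simp add: add_divide_distrib)
  have "norm (\<Sum>y<L. unity L (int y) * E y) \<le> (\<Sum>y<L. pi * real L * real p / 2 * (1 / (real t)\<^sup>2))"
    using nE by (intro order_trans[OF norm_sum] sum_mono) (simp add: norm_mult)
  then have err: "norm ((\<Sum>y<L. unity L (int y) * E y) / of_nat L) \<le> pi * real L * real p / 2 * (1 / (real t)\<^sup>2)"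
    using assms by (simp add: norm_divide divide_le_eq mult.commute)
  have "norm (wave_coeff p L a) * real p / (2 * pi) * (1 / real t)
      = norm (wave_coeff p L a) / (2 * pi * real t / real p)"
    using t p by (simp add: field_simps)
  also have "\<dots> \<le> norm (wave_coeff p L a) / norm (w - 1)"
    using norm_unity_diff_1_le[of p "int t"] w1 t p
    by (intro divide_left_mono mult_pos_pos) (auto simp: w_def)
  also have "\<dots> = norm (w ^ a * wave_coeff p L a / (w - 1))"
    by (simp add: norm_mult norm_divide norm_power w_def)
  also have "\<dots> \<le> norm (wave_sum p L a t) + norm ((\<Sum>y<L. unity L (int y) * E y) / of_nat L)"
    using norm_triangle_ineq4[of "wave_sum p L a t" "(\<Sum>y<L. unity L (int y) * E y) / of_nat L"] by (simp add: S)
  finally show ?thesis using err by linarith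
qed

text \<open>Summing the pointwise bound over 2 L \<le> t \<le> p / 2 gives a harmonic sum with
  factor p / (4 pi), the coefficient being at least 1/2. The error is at most (pi / 2) p, because L
  times the sum of 1 / t^2 is at most 1; pi < 4 then yields the 2.\<close>

lemma mean_norm_wave_sum_ge:
  assumes L: "2 \<le> L" "L \<le> p" and a: "5 * p \<le> 6 * (a * L)" "a * L \<le> p"
  shows "(\<Sum>t<p. norm (wave_sum p L a t)) / real p \<ge> ln (real p / (4 * real L)) / (4 * pi) - 2"
proof -
  define T where "T = p div 2 + 1"
  have p: "p \<ge> 2" using L by simp
  have T: "real p / 2 \<le> real T" "T \<le> p" unfolding T_def using p by linarith+
  show ?thesis
  proof (cases "2 * L \<le> T")
    \<comment> \<open>Now p < 4 L, so the logarithm is not positive and the claim is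
      trivial.\<close>
    case False
    have "real p / (4 * real L) \<le> 1"
      using False T L by (simp add: divide_le_eq)
    then have "ln (real p / (4 * real L)) \<le> 0"
      using p L by simp
    then have "ln (real p / (4 * real L)) / (4 * pi) \<le> 0"
      by (simp add: divide_le_0_iff)
    then show ?thesis
      using sum_nonneg[of "{..<p}" "\<lambda>t. norm (wave_sum p L a t)"] by (smt (verit) divide_nonneg_nonneg norm_ge_zero of_nat_0_le_iff)
  next
    case True
    have c: "norm (wave_coeff p L a) \<ge> 1 / 2"
      using assms p by (intro norm_wave_coeff_ge) auto
    have 1: "ln (real p / (4 * real L)) \<le> (\<Sum>t=2*L..<T. 1 / real t)"
    proof -
      have "real p / (4 * real L) \<le> real T / real (2 * L)"
        using T L by (simp add: field_simps)
      then have "ln (real p / (4 * real L)) \<le> ln (real T / real (2 * L))"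
        using p L by (intro ln_mono) auto
      also have "\<dots> \<le> (\<Sum>t=2*L..<T. 1 / real t)"
        using L True by (intro sum_inverse_ge_ln) auto
      finally show ?thesis .
    qed
    have 2: "real L * (\<Sum>t=2*L..<T. 1 / (real t)\<^sup>2) \<le> 1"
    proof -
      have "(\<Sum>t=2*L..<T. 1 / (real t)\<^sup>2) \<le> 1 / (real (2 * L) - 1) - 1 / (real T - 1)"
        using L True by (intro sum_inverse_squares_le) auto
      also have "\<dots> \<le> 1 / (real (2 * L) - 1)"
        using True L by simp
      also have "\<dots> \<le> 1 / real L"
        using L by (intro divide_left_mono) auto
      finally show ?thesis using L by (simp add: field_simps)
    qed
    have "real p * (ln (real p / (4 * real L)) / (4 * pi) - 2)
        \<le> real p / (4 * pi) * (\<Sum>t=2*L..<T. 1 / real t) - real p * (pi / 2) * (real L * (\<Sum>t=2*L..<T. 1 / (real t)\<^sup>2))"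
    proof -
      have "real p / (4 * pi) * ln (real p / (4 * real L)) \<le> real p / (4 * pi) * (\<Sum>t=2*L..<T. 1 / real t)"
        using 1 by (intro mult_left_mono) auto
      moreover have "real p * (pi / 2) * (real L * (\<Sum>t=2*L..<T. 1 / (real t)\<^sup>2)) \<le> real p * 2 * 1"
        using 2 pi_less_4 by (intro mult_mono) (auto intro!: mult_nonneg_nonneg sum_nonneg)
      ultimately show ?thesis by (simp add: algebra_simps)
    qed
    also have "\<dots> = (\<Sum>t=2*L..<T. (1 / 2) * real p / (2 * pi) * (1 / real t) - pi * real L * real p / 2 * (1 / (real t)\<^sup>2))"
      by (simp add: sum_subtractf sum_distrib_left mult_ac)
    also have "\<dots> \<le> (\<Sum>t=2*L..<T. norm (wave_sum p L a t))"
    proof (rule sum_mono)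
      fix t assume t: "t \<in> {2*L..<T}"
      have "(1 / 2) * real p / (2 * pi) * (1 / real t) \<le> norm (wave_coeff p L a) * real p / (2 * pi) * (1 / real t)"
        using c by (intro mult_right_mono divide_right_mono) auto
      moreover have "norm (wave_sum p L a t) \<ge>
          norm (wave_coeff p L a) * real p / (2 * pi) * (1 / real t) - pi * real L * real p / 2 * (1 / (real t)\<^sup>2)"
        using t L by (intro norm_wave_sum_ge) (auto simp: T_def)
      ultimately show "(1 / 2) * real p / (2 * pi) * (1 / real t) - pi * real L * real p / 2 * (1 / (real t)\<^sup>2)
          \<le> norm (wave_sum p L a t)" by linarith
    qed
    also have "\<dots> \<le> (\<Sum>t<p. norm (wave_sum p L a t))"
      using T by (intro sum_mono2) auto
    finally show ?thesis
      using p by (simp add: le_divide_eq mult.commute)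
  qed
qed

context vilenkin_system
begin

subsection \<open>Lower bounds for the kernels\<close>

lemma zero_in_space: "(\<lambda>_. 0) \<in> space G"
  by (simp add: in_space_G)

lemma sets_cyl_zero: "cyl (\<lambda>_. 0) J \<in> sets G"
  by (rule sets_cyl) auto

lemma vilenkin_zero [simp]: "vilenkin m n (\<lambda>_. 0) = 1"
  by (simp add: vilenkin_def rademacher_unity)

lemma vilenkin_cyl_zero:
  assumes "x \<in> cyl (\<lambda>_. 0) J" "n < M J"
  shows "vilenkin m n x = 1"
  using assms by (simp add: vilenkin_eq_prod rademacher_unity cyl_def)

lemma kernel_zero: "kernel n x (\<lambda>_. 0) = (\<Sum>j<n. vilenkin m j x)"
  by (simp add: kernel_def)

lemma kernel_cyl_zero:
  assumes "x \<in> cyl (\<lambda>_. 0) J" "n \<le> M J"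
  shows "kernel n x (\<lambda>_. 0) = of_nat n"
  using assms vilenkin_cyl_zero[OF assms(1)] by (simp add: kernel_zero)

lemma sum_gen_power_Suc:
  fixes f :: "nat \<Rightarrow> 'b :: comm_monoid_add"
  shows "(\<Sum>k<M (Suc J). f k) = (\<Sum>a<m J. \<Sum>b<M J. f (a * M J + b))"
  using sum_lessThan_add_mult[of f "m J" "M J" 0] by (simp add: gen_power_simps)

text \<open>Off the cylinder K_(M_J) vanishes, so the modulus of a partial sum of
  \<open>wave_atom J L\<close> of order a M_J + b is there |K_b| times that of a single coefficient.
  The integral records this share of the norm.\<close>

definition outer_norm :: "nat \<Rightarrow> nat \<Rightarrow> real" where
  "outer_norm J n = (LINT x|G. indicator (space G - cyl (\<lambda>_. 0) J) x *\<^sub>R norm (kernel n x (\<lambda>_. 0)))"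

lemma integrable_outer:
  "integrable G (\<lambda>x. indicator (space G - cyl (\<lambda>_. 0) J) x *\<^sub>R norm (kernel n x (\<lambda>_. 0)))"
  using sets_cyl_zero[of J] by (intro integrable_mult_indicator) auto

text \<open>The complement of the cylinder of level J + 1 consists of the complement at level J,
  where the kernel has modulus |K_b|, and of the fibres x_J = t \<noteq> 0 of the cylinder of level
  J, where K_b and K_(M_J) have the constant values b and M_J.\<close>

lemma outer_norm_Suc:
  assumes "a < m J" "b < M J"
  shows "outer_norm (Suc J) (a * M J + b) = outer_norm J b +
    (\<Sum>t=1..<m J. norm ((\<Sum>i<a. unity (m J) (int t) ^ i) + of_nat b / of_nat (M J) * unity (m J) (int t) ^ a)) / real (m J)"
proof -
  let ?w = "\<lambda>t. unity (m J) (int t)"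
  define h where "h = (\<lambda>t. if t = 0 then 0 else
    norm (of_nat (M J) * (\<Sum>i<a. ?w t ^ i) + ?w t ^ a * of_nat b))"
  have pw: "indicator (space G - cyl (\<lambda>_. 0) (Suc J)) x *\<^sub>R norm (kernel (a * M J + b) x (\<lambda>_. 0))
      = indicator (space G - cyl (\<lambda>_. 0) J) x *\<^sub>R norm (kernel b x (\<lambda>_. 0))
        + indicator (cyl (\<lambda>_. 0) J) x *\<^sub>R h (x J)" if x: "x \<in> space G" for x
  proof (cases "x \<in> cyl (\<lambda>_. 0) J")
    case True
    have "norm (kernel (a * M J + b) x (\<lambda>_. 0)) = norm (of_nat (M J) * (\<Sum>i<a. ?w (x J) ^ i) + ?w (x J) ^ a * of_nat b)"
      using assms True by (simp add: kernel_add kernel_cyl_zero mult.commute)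
    then show ?thesis using True x by (auto simp: h_def cyl_Suc)
  next
    case False
    have "norm (kernel (a * M J + b) x (\<lambda>_. 0)) = norm (kernel b x (\<lambda>_. 0))"
      using assms False x zero_in_space by (simp add: kernel_add kernel_gen_power norm_mult norm_power)
    then show ?thesis using False x by (auto simp: cyl_Suc)
  qed
  have "outer_norm (Suc J) (a * M J + b)
      = (LINT x|G. indicator (space G - cyl (\<lambda>_. 0) J) x *\<^sub>R norm (kernel b x (\<lambda>_. 0))
        + indicator (cyl (\<lambda>_. 0) J) x *\<^sub>R h (x J))"
    unfolding outer_norm_def using pw by (rule Bochner_Integration.integral_cong[OF refl])
  also have "\<dots> = outer_norm J b + (LINT x|G. indicator (cyl (\<lambda>_. 0) J) x *\<^sub>R h (x J))"
    unfolding outer_norm_def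
    by (rule Bochner_Integration.integral_add[OF integrable_outer integral_cyl_coordinate(1)[OF zero_in_space]])
  also have "(LINT x|G. indicator (cyl (\<lambda>_. 0) J) x *\<^sub>R h (x J)) = (\<Sum>t<m J. h t) / real (M (Suc J))"
    using integral_cyl_coordinate(2)[OF zero_in_space, of J h] by simp
  also have "(\<Sum>t<m J. h t) = (\<Sum>t=1..<m J. h t)"
    by (rule sum.mono_neutral_right) (auto simp: h_def)
  also have "(\<Sum>t=1..<m J. h t) = real (M J) * (\<Sum>t=1..<m J. norm ((\<Sum>i<a. ?w t ^ i) + of_nat b / of_nat (M J) * ?w t ^ a))"
    unfolding sum_distrib_left
  proof (rule sum.cong[OF refl])
    fix t assume "t \<in> {1..<m J}"
    have "of_nat (M J) * (\<Sum>i<a. ?w t ^ i) + ?w t ^ a * of_nat b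
        = of_nat (M J) * ((\<Sum>i<a. ?w t ^ i) + of_nat b / of_nat (M J) * ?w t ^ a)"
      by (simp add: field_simps)
    then have "norm (of_nat (M J) * (\<Sum>i<a. ?w t ^ i) + ?w t ^ a * of_nat b)
        = norm (of_nat (M J) :: complex) * norm ((\<Sum>i<a. ?w t ^ i) + of_nat b / of_nat (M J) * ?w t ^ a)"
      by (simp only: norm_mult)
    then show "h t = real (M J) * norm ((\<Sum>i<a. ?w t ^ i) + of_nat b / of_nat (M J) * ?w t ^ a)"
      using \<open>t \<in> _\<close> by (simp add: h_def)
  qed
  finally show ?thesis by (simp add: gen_power_simps)
qed

text \<open>Averaging over the orders is essential: the outer norm is at most 1 at each M_i with i <
  J. The average over the digit \<open>a\<close> gains ln m_J / (2 pi) at each level, the lower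
  digits entering only as the shift b / M_J in \<open>sum_norm_geometric_shift_ge\<close>, and the
  gains of all levels add up to a multiple of ln M_J.\<close>

lemma sum_outer_norm_ge: "(\<Sum>n<M J. outer_norm J n) \<ge> real (M J) * ln (real (M J)) / (2 * pi)"
proof (induction J)
  case 0
  have "outer_norm 0 n = 0" for n
    by (simp add: outer_norm_def cyl_0)
  then show ?case by (simp add: gen_power_simps)
next
  case (Suc J)
  let ?w = "\<lambda>t. unity (m J) (int t)"
  let ?N = "\<lambda>a b t. norm ((\<Sum>i<a. ?w t ^ i) + of_nat b / of_nat (M J) * ?w t ^ a)"
  have inner: "(\<Sum>a<m J. (\<Sum>t=1..<m J. ?N a b t) / real (m J)) \<ge> real (m J) * ln (real (m J)) / (2 * pi)" for b
  proof -
    have "real (m J) * ln (real (m J)) / (2 * pi) \<le> (\<Sum>t=1..<m J. 1 / norm (?w t - 1))"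
      using m_ge_2[of J] by (intro sum_inverse_norm_unity_ge) auto
    also have "\<dots> = (\<Sum>t=1..<m J. real (m J) / norm (?w t - 1)) / real (m J)"
      by (simp add: sum_divide_distrib)
    also have "\<dots> \<le> (\<Sum>t=1..<m J. \<Sum>a<m J. ?N a b t) / real (m J)"
    proof (intro divide_right_mono sum_mono)
      fix t assume t: "t \<in> {1..<m J}"
      show "real (m J) / norm (?w t - 1) \<le> (\<Sum>a<m J. ?N a b t)"
        using t by (intro sum_norm_geometric_shift_ge unity_power_order unity_neq_1) auto
    qed simp
    also have "\<dots> = (\<Sum>a<m J. (\<Sum>t=1..<m J. ?N a b t) / real (m J))"
      by (subst sum.swap) (simp only: sum_divide_distrib)
    finally show ?thesis .
  qed
  have "real (M (Suc J)) * ln (real (M (Suc J))) / (2 * pi)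
      = real (m J) * (real (M J) * ln (real (M J)) / (2 * pi)) + real (M J) * (real (m J) * ln (real (m J)) / (2 * pi))"
    by (simp add: gen_power_simps ln_mult algebra_simps add_divide_distrib)
  also have "\<dots> \<le> real (m J) * (\<Sum>b<M J. outer_norm J b)
      + (\<Sum>b<M J. \<Sum>a<m J. (\<Sum>t=1..<m J. ?N a b t) / real (m J))"
  proof (intro add_mono mult_left_mono Suc.IH)
    have "(\<Sum>b<M J. real (m J) * ln (real (m J)) / (2 * pi)) \<le> (\<Sum>b<M J. \<Sum>a<m J. (\<Sum>t=1..<m J. ?N a b t) / real (m J))"
      by (intro sum_mono inner)
    then show "real (M J) * (real (m J) * ln (real (m J)) / (2 * pi)) \<le> (\<Sum>b<M J. \<Sum>a<m J. (\<Sum>t=1..<m J. ?N a b t) / real (m J))"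
      by simp
  qed simp
  also have "\<dots> = (\<Sum>a<m J. \<Sum>b<M J. outer_norm J b + (\<Sum>t=1..<m J. ?N a b t) / real (m J))"
    by (subst sum.swap) (simp add: sum.distrib)
  also have "\<dots> = (\<Sum>a<m J. \<Sum>b<M J. outer_norm (Suc J) (a * M J + b))"
    by (intro sum.cong refl) (simp add: outer_norm_Suc)
  finally show ?case by (simp only: sum_gen_power_Suc)
qed

end

text \<open>Keep the left half \<open>i\<close> times; a final length of at least 1 guarantees that
  every earlier length was at least 2, as the halving rule demands.\<close>

lemma initial_dyadic_block:
  assumes "1 \<le> p div 2 ^ i"
  shows "{0..<p div 2 ^ i} \<in> dyadic_blocks p"
  using assms
proof (induction i)
  case 0
  then show ?case by (simp add: dyadic_blocks.whole)
next
  case (Suc i)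
  have eq: "p div 2 ^ Suc i = p div 2 ^ i div 2"
    by (simp add: div_mult2_eq[symmetric] mult.commute)
  then have "2 \<le> p div 2 ^ i" using Suc.prems by simp
  then have "{0..<0 + p div 2 ^ i} \<in> dyadic_blocks p"
    using Suc.IH by simp
  from dyadic_blocks.left[OF this \<open>2 \<le> p div 2 ^ i\<close>] show ?case
    unfolding eq by simp
qed

lemma sum_if_less:
  fixes f :: "nat \<Rightarrow> 'b :: comm_monoid_add"
  assumes "L \<le> p"
  shows "(\<Sum>t<p. if t < L then f t else 0) = (\<Sum>t<L. f t)"
proof -
  have "{..<p} \<inter> {t. t < L} = {..<L}" using assms by auto
  then show ?thesis by (simp add: sum.If_cases)
qed

text \<open>The blocks are disjoint and lie in [0, n]. \<open>F 0 = 0\<close> takes care of the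
  index 0, which a block may contain but the range 1..n does not.\<close>

lemma sum_blocks_le:
  fixes F :: "nat \<Rightarrow> real"
  assumes A: "\<And>a. a \<in> A \<Longrightarrow> (a + 1) * N \<le> n" and N: "0 < N" and F: "\<And>k. 0 \<le> F k" "F 0 = 0"
  shows "(\<Sum>a\<in>A. \<Sum>b<N. F (a * N + b)) \<le> (\<Sum>k=1..n. F k)"
proof -
  have "A \<subseteq> {..<n div N}"
  proof
    fix a assume "a \<in> A"
    then have "(a + 1) * N \<le> n" by (rule A)
    then have "a + 1 \<le> n div N" using N by (simp only: less_eq_div_iff_mult_less_eq)
    then show "a \<in> {..<n div N}" by simp
  qed
  then have "(\<Sum>a\<in>A. \<Sum>b<N. F (a * N + b)) \<le> (\<Sum>a<n div N. \<Sum>b<N. F (a * N + b))"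
    using F by (intro sum_mono2 sum_nonneg) auto
  also have "\<dots> = (\<Sum>k<n div N * N. F k)"
    using sum_lessThan_add_mult[of F "n div N" N 0] by simp
  also have "\<dots> \<le> (\<Sum>k\<in>insert 0 {1..n}. F k)"
  proof (rule sum_mono2)
    have "n div N * N \<le> n" by simp
    then show "{..<n div N * N} \<subseteq> insert 0 {1..n}" by (auto simp del: div_times_less_eq_dividend)
  qed (use F in auto)
  also have "\<dots> = (\<Sum>k=1..n. F k)"
    using F by (subst sum.insert) auto
  finally show ?thesis .
qed

context vilenkin_system
begin

subsection \<open>Atoms with large partial sums\<close>

text \<open>The height M_J m_J / L is 1 / |I| for the interval I carrying the wave, the largest an
  atom may have. The form, an indicator times a function of x_J, is that of
  \<open>integral_cyl_coordinate\<close>.\<close>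

definition wave_atom :: "nat \<Rightarrow> nat \<Rightarrow> (nat \<Rightarrow> nat) \<Rightarrow> complex" where
  "wave_atom J L x = indicator (cyl (\<lambda>_. 0) J) x *\<^sub>R
    (of_nat (M J) * (if x J < L then of_nat (m J) / of_nat L * unity L (int (x J)) else 0))"

lemma integrable_wave_atom: "integrable G (wave_atom J L)"
  unfolding wave_atom_def[abs_def]
  by (rule integral_cyl_coordinate(1)[OF zero_in_space, where
        h = "\<lambda>t. of_nat (M J) * (if t < L then of_nat (m J) / of_nat L * unity L (int t) else 0)"])

lemma atom_wave_atom:
  assumes L: "2 \<le> L" "L \<le> m J" and block: "{0..<L} \<in> dyadic_blocks (m J)"
  shows "atom m (wave_atom J L)"
proof -
  let ?o = "\<lambda>_::nat. 0::nat"
  define I where "I = (\<Union>k\<in>{0..<L}. cylinder m J ?o k)"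
  have vi: "vilenkin_interval m I"
    unfolding vilenkin_interval_def I_def using block zero_in_space by blast
  have Is: "I \<in> sets G" using vi by (rule sets_vilenkin_interval)
  have mem: "x \<in> I \<longleftrightarrow> x \<in> cyl ?o J \<and> x J < L" for x
    by (auto simp: I_def cylinder_def cyl_def)
  have "measure G I = (LINT x|G. indicator I x)"
    using Is by simp
  also have "\<dots> = (LINT x|G. indicator (cyl ?o J) x *\<^sub>R (if x J < L then 1 else 0))"
    by (intro Bochner_Integration.integral_cong refl) (auto simp: indicator_def mem)
  also have "\<dots> = (\<Sum>t<m J. if t < L then 1 else 0) / real (M (Suc J))"
    using integral_cyl_coordinate(2)[OF zero_in_space, of J "\<lambda>t. if t < L then 1 else 0 :: real"] by simp
  also have "(\<Sum>t<m J. if t < L then 1 else 0 :: real) = real L"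
    using sum_if_less[OF L(2), of "\<lambda>_. 1 :: real"] by simp
  finally have mI: "measure G I = real L / real (M (Suc J))" .
  have supp: "wave_atom J L x = 0" if "x \<notin> I" for x
    using that by (auto simp: wave_atom_def mem indicator_def)
  have bd: "norm (wave_atom J L x) \<le> 1 / measure G I" for x
    using L by (auto simp: wave_atom_def mI indicator_def norm_mult norm_divide gen_power_simps mult.commute)
  have "(LINT x:I|G. wave_atom J L x) = (LINT x|G. wave_atom J L x)"
    unfolding set_lebesgue_integral_def
    by (intro Bochner_Integration.integral_cong refl) (auto simp: indicator_def supp)
  also have "\<dots> = (1 / real (M (Suc J))) *\<^sub>R (\<Sum>t<m J. of_nat (M J) * (if t < L then of_nat (m J) / of_nat L * unity L (int t) else 0))"
    unfolding wave_atom_def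
    by (rule integral_cyl_coordinate(2)[OF zero_in_space, where
        h = "\<lambda>t. of_nat (M J) * (if t < L then of_nat (m J) / of_nat L * unity L (int t) else 0)"])
  also have "\<dots> = 0"
    by (simp only: sum_distrib_left[symmetric] sum_if_less[OF L(2)] sum_unity_eq_0[OF L(1)] mult_zero_right scaleR_zero_right)
  finally have "(LINT x:I|G. wave_atom J L x) = 0" .
  then show ?thesis
    unfolding atom_def using vi supp bd integrable_wave_atom[of J L] by auto
qed

text \<open>On the support of the atom the first J coordinates vanish, so \<psi>_b is 1 there and
  the coefficient is constant on each block of M_J frequencies.\<close>

lemma fourier_coeff_wave_atom:
  assumes "L \<le> m J" "0 < L" "a < m J" "b < M J"
  shows "fourier_coeff m (wave_atom J L) (a * M J + b) = wave_coeff (m J) L a"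
proof -
  let ?o = "\<lambda>_::nat. 0::nat"
  let ?g = "\<lambda>t. if t < L then of_nat (m J) / of_nat L * unity L (int t) else 0"
  let ?h = "\<lambda>t. of_nat (M J) * ?g t * unity (m J) (- (int a * int t))"
  have "fourier_coeff m (wave_atom J L) (a * M J + b) = (LINT x|G. indicator (cyl ?o J) x *\<^sub>R ?h (x J))"
    unfolding fourier_coeff_def
  proof (rule Bochner_Integration.integral_cong[OF refl])
    fix x assume "x \<in> space G"
    show "wave_atom J L x * cnj (vilenkin m (a * M J + b) x) = indicator (cyl ?o J) x *\<^sub>R ?h (x J)"
    proof (cases "x \<in> cyl ?o J")
      case True
      have "cnj (vilenkin m (a * M J + b) x) = unity (m J) (- (int a * int (x J)))"
        using assms True by (simp add: vilenkin_add vilenkin_cyl_zero rademacher_unity unity_power cnj_unity)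
      then show ?thesis using True by (simp add: wave_atom_def)
    qed (simp add: wave_atom_def)
  qed
  also have "\<dots> = (1 / real (M (Suc J))) *\<^sub>R (\<Sum>t<m J. ?h t)"
    by (rule integral_cyl_coordinate(2)[OF zero_in_space, where h = ?h])
  also have "(\<Sum>t<m J. ?h t) = (\<Sum>t<m J. if t < L then of_nat (M J) * (of_nat (m J) / of_nat L) * (unity L (int t) * unity (m J) (- (int a * int t))) else 0)"
    by (intro sum.cong refl) auto
  also have "\<dots> = (\<Sum>t<L. of_nat (M J) * (of_nat (m J) / of_nat L) * (unity L (int t) * unity (m J) (- (int a * int t))))"
    by (rule sum_if_less[OF assms(1)])
  also have "\<dots> = of_nat (M J) * (of_nat (m J) / of_nat L) * (\<Sum>t<L. unity L (int t) * unity (m J) (- (int a * int t)))"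
    by (simp only: sum_distrib_left)
  also have "(1 / real (M (Suc J))) *\<^sub>R \<dots> = wave_coeff (m J) L a"
    by (simp add: wave_coeff_def gen_power_simps scaleR_conv_of_real)
  finally show ?thesis .
qed

text \<open>Each complete block of frequencies has a constant coefficient and contributes a multiple
  of K_(M_J); the incomplete last block contributes a multiple of K_b.\<close>

lemma partial_sum_wave_atom:
  assumes "L \<le> m J" "0 < L" "a < m J" "b < M J"
  shows "partial_sum m (a * M J + b) (wave_atom J L) x =
    wave_sum (m J) L a (x J) * kernel (M J) x (\<lambda>_. 0)
      + wave_coeff (m J) L a * unity (m J) (int (x J)) ^ a * kernel b x (\<lambda>_. 0)"
proof -
  have v: "fourier_coeff m (wave_atom J L) (i * M J + j) * vilenkin m (i * M J + j) x
      = wave_coeff (m J) L i * unity (m J) (int (x J)) ^ i * vilenkin m j x" if "i \<le> a" "j < M J" for i j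
    using that assms by (simp add: fourier_coeff_wave_atom vilenkin_add rademacher_unity)
  have "partial_sum m (a * M J + b) (wave_atom J L) x =
     (\<Sum>i<a. \<Sum>j<M J. wave_coeff (m J) L i * unity (m J) (int (x J)) ^ i * vilenkin m j x)
     + (\<Sum>j<b. wave_coeff (m J) L a * unity (m J) (int (x J)) ^ a * vilenkin m j x)"
    unfolding partial_sum_def sum_lessThan_add_mult using assms
    by (intro arg_cong2[where f = "(+)"] sum.cong refl v) auto
  then show ?thesis
    by (simp add: kernel_zero wave_sum_def sum_distrib_left[symmetric] sum_distrib_right[symmetric])
qed

text \<open>Off the cylinder only the K_b term survives, with a coefficient of modulus at least 1/2.
  On the cylinder this term is at most M_J on a set of measure 1 / M_J and costs at most 1; with the
  2 lost in the cyclic mean this makes 3.\<close>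

lemma L1_norm_partial_sum_wave_atom_ge:
  assumes L: "2 \<le> L" "L \<le> m J" and a: "5 * m J \<le> 6 * (a * L)" "a * L \<le> m J" and b: "b < M J"
  shows "L1_norm m (partial_sum m (a * M J + b) (wave_atom J L)) \<ge>
    outer_norm J b / 2 + ln (real (m J) / (4 * real L)) / (4 * pi) - 3"
proof -
  let ?o = "\<lambda>_::nat. 0::nat"
  let ?c = "wave_coeff (m J) L a"
  have "2 * a \<le> a * L" using L by simp
  then have "2 * a \<le> m J" using a(2) by linarith
  then have am: "a < m J" using m_pos[of J] by linarith
  define h where "h = (\<lambda>t. norm (wave_sum (m J) L a t * of_nat (M J) + ?c * unity (m J) (int t) ^ a * of_nat b))"
  have pw: "norm (partial_sum m (a * M J + b) (wave_atom J L) x)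
      = norm ?c * (indicator (space G - cyl ?o J) x *\<^sub>R norm (kernel b x ?o)) + indicator (cyl ?o J) x *\<^sub>R h (x J)"
    if "x \<in> space G" for x
  proof (cases "x \<in> cyl ?o J")
    case True
    then show ?thesis
      using L am b by (simp add: partial_sum_wave_atom kernel_cyl_zero h_def)
  next
    case False
    then show ?thesis
      using L am b that zero_in_space
      by (simp add: partial_sum_wave_atom kernel_gen_power norm_mult norm_power)
  qed
  have "L1_norm m (partial_sum m (a * M J + b) (wave_atom J L))
      = (LINT x|G. norm ?c * (indicator (space G - cyl ?o J) x *\<^sub>R norm (kernel b x ?o)) + indicator (cyl ?o J) x *\<^sub>R h (x J))"
    unfolding L1_norm_def using pw by (rule Bochner_Integration.integral_cong[OF refl])
  also have "\<dots> = norm ?c * outer_norm J b + (LINT x|G. indicator (cyl ?o J) x *\<^sub>R h (x J))"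
    unfolding outer_norm_def
    by (subst Bochner_Integration.integral_add[OF integrable_mult_right[OF integrable_outer] integral_cyl_coordinate(1)[OF zero_in_space]])
      (simp only: integral_mult_right_zero)
  also have "(LINT x|G. indicator (cyl ?o J) x *\<^sub>R h (x J)) = (\<Sum>t<m J. h t) / real (M (Suc J))"
    using integral_cyl_coordinate(2)[OF zero_in_space, of J h] by simp
  finally have eq: "L1_norm m (partial_sum m (a * M J + b) (wave_atom J L))
      = norm ?c * outer_norm J b + (\<Sum>t<m J. h t) / real (M (Suc J))" .
  have c: "norm ?c \<ge> 1 / 2"
    using L a by (intro norm_wave_coeff_ge) auto
  have "outer_norm J b \<ge> 0"
    unfolding outer_norm_def by (intro integral_nonneg_AE) auto
  then have 1: "norm ?c * outer_norm J b \<ge> outer_norm J b / 2"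
    using mult_right_mono[OF c, of "outer_norm J b"] by simp
  have h_ge: "h t \<ge> real (M J) * norm (wave_sum (m J) L a t) - real (M J)" for t
  proof -
    have "norm (?c * unity (m J) (int t) ^ a * of_nat b) \<le> 1 * real (M J)"
      unfolding norm_mult using norm_wave_coeff_le[of "m J" L a] b
      by (intro mult_mono) (auto simp: norm_power)
    moreover have "norm (wave_sum (m J) L a t * of_nat (M J))
        \<le> h t + norm (?c * unity (m J) (int t) ^ a * of_nat b)"
      unfolding h_def
      using norm_triangle_ineq4[of "wave_sum (m J) L a t * of_nat (M J) + ?c * unity (m J) (int t) ^ a * of_nat b"
          "?c * unity (m J) (int t) ^ a * of_nat b"] by simp
    ultimately show ?thesis by (simp add: norm_mult mult.commute)
  qed
  have "(\<Sum>t<m J. norm (wave_sum (m J) L a t)) / real (m J) - 1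
      = (\<Sum>t<m J. real (M J) * norm (wave_sum (m J) L a t) - real (M J)) / real (M (Suc J))"
    by (simp add: sum_subtractf sum_distrib_left[symmetric] gen_power_simps diff_divide_distrib)
  also have "\<dots> \<le> (\<Sum>t<m J. h t) / real (M (Suc J))"
    using h_ge by (intro divide_right_mono sum_mono) auto
  finally show ?thesis
    using eq 1 mean_norm_wave_sum_ge[OF L a] by linarith
qed

text \<open>The mean over \<open>b\<close> of the outer norm is at least ln M_J / (2 pi), and the
  coefficient halves this. The factor 1 / (4 pi) is then also that of the other logarithm, so the
  two merge into one.\<close>

lemma sum_L1_norm_wave_atom_ge:
  assumes L: "2 \<le> L" "L \<le> m J" and a: "5 * m J \<le> 6 * (a * L)" "a * L \<le> m J"
  shows "(\<Sum>b<M J. L1_norm m (partial_sum m (a * M J + b) (wave_atom J L)))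
    \<ge> real (M J) * (ln (real (M J) * real (m J) / (4 * real L)) / (4 * pi) - 3)"
proof -
  have "ln (real (M J) * real (m J) / (4 * real L)) = ln (real (M J)) + ln (real (m J) / (4 * real L))"
    using L ln_mult[of "real (M J)" "real (m J) / (4 * real L)"] by simp
  moreover have alg: "z * ((x + y) / (4 * pi) - 3) = z * x / (2 * pi) / 2 + z * (y / (4 * pi) - 3)"
    for x y z :: real
    by (simp add: field_simps)
  ultimately have "real (M J) * (ln (real (M J) * real (m J) / (4 * real L)) / (4 * pi) - 3)
      = (real (M J) * ln (real (M J)) / (2 * pi)) / 2 + (\<Sum>b<M J. ln (real (m J) / (4 * real L)) / (4 * pi) - 3)"
    using alg[of "real (M J)" "ln (real (M J))" "ln (real (m J) / (4 * real L))"]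
    by (simp only: sum_constant card_lessThan)
  also have "\<dots> \<le> (\<Sum>n<M J. outer_norm J n) / 2 + (\<Sum>b<M J. ln (real (m J) / (4 * real L)) / (4 * pi) - 3)"
    using sum_outer_norm_ge[of J] by (intro add_mono divide_right_mono) auto
  also have "\<dots> = (\<Sum>b<M J. outer_norm J b / 2 + ln (real (m J) / (4 * real L)) / (4 * pi) - 3)"
    by (simp add: sum.distrib sum_subtractf sum_divide_distrib right_diff_distrib)
  also have "\<dots> \<le> (\<Sum>b<M J. L1_norm m (partial_sum m (a * M J + b) (wave_atom J L)))"
    using assms by (intro sum_mono L1_norm_partial_sum_wave_atom_ge) auto
  finally show ?thesis .
qed

lemma ex_atom_sum_L1_norm_ge:
  assumes n: "n \<ge> 2" and pos: "ln (real n / 256) / (4 * pi) \<ge> 3"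
  shows "\<exists>f. atom m f \<and>
    (\<Sum>k=1..n. L1_norm m (partial_sum m k f)) \<ge> real n / 96 * (ln (real n / 256) / (4 * pi) - 3)"
proof -
  \<comment> \<open>Choosing \<open>J\<close> for n div 2 instead of n ensures 2 M_J \<le> n, so
    that the whole block a = 1 lies below n.\<close>
  have "n div 2 \<ge> 1" using n by simp
  then obtain J where J: "M J \<le> n div 2" "n div 2 < M (Suc J)"
    by (rule ex_gen_power_bounds)
  define p where "p = m J"
  define \<beta> where "\<beta> = ln (real n / 256) / (4 * pi) - 3"
  have \<beta>: "\<beta> \<ge> 0" using pos by (simp add: \<beta>_def)
  have J1: "2 * M J \<le> n" using J(1) by simp
  have J2: "n < 2 * (p * M J)" using J(2) by (simp add: gen_power_simps p_def)
  have p2: "p \<ge> 2" using m_ge_2 by (simp add: p_def)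
  \<comment> \<open>Here \<open>A\<close> collects digits with large coefficients. The condition
    \<open>card\<close> says that their blocks fill a fixed share of 1..n, and \<open>ln\<close>
    that the logarithm obtained is comparable with ln n.\<close>
  have key: "\<exists>f. atom m f \<and> (\<Sum>k=1..n. L1_norm m (partial_sum m k f)) \<ge> real n / 96 * \<beta>"
    if L: "2 \<le> L" "L \<le> p" "{0..<L} \<in> dyadic_blocks p"
      and A: "\<And>a. a \<in> A \<Longrightarrow> 5 * p \<le> 6 * (a * L) \<and> a * L \<le> p \<and> (a + 1) * M J \<le> n"
      and card: "real n \<le> 96 * (real (card A) * real (M J))"
      and ln: "real n / 256 \<le> real (M J) * real p / (4 * real L)"
    for L A
  proof (intro exI conjI)
    show "atom m (wave_atom J L)"
      using L by (intro atom_wave_atom) (auto simp: p_def)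
    have "ln (real n / 256) \<le> ln (real (M J) * real p / (4 * real L))"
      using ln n by (intro ln_mono) auto
    then have \<beta>': "\<beta> \<le> ln (real (M J) * real p / (4 * real L)) / (4 * pi) - 3"
      unfolding \<beta>_def by (intro diff_right_mono divide_right_mono) auto
    have "real n / 96 * \<beta> \<le> real (card A) * real (M J) * \<beta>"
      using card \<beta> by (intro mult_right_mono) auto
    also have "\<dots> = (\<Sum>a\<in>A. real (M J) * \<beta>)"
      by simp
    also have "\<dots> \<le> (\<Sum>a\<in>A. \<Sum>b<M J. L1_norm m (partial_sum m (a * M J + b) (wave_atom J L)))"
    proof (rule sum_mono)
      fix a assume a: "a \<in> A"
      have "real (M J) * \<beta> \<le> real (M J) * (ln (real (M J) * real p / (4 * real L)) / (4 * pi) - 3)"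
        using \<beta>' by (intro mult_left_mono) auto
      also have "\<dots> \<le> (\<Sum>b<M J. L1_norm m (partial_sum m (a * M J + b) (wave_atom J L)))"
        unfolding p_def using L A[OF a] by (intro sum_L1_norm_wave_atom_ge) (auto simp: p_def)
      finally show "real (M J) * \<beta> \<le> (\<Sum>b<M J. L1_norm m (partial_sum m (a * M J + b) (wave_atom J L)))" .
    qed
    also have "\<dots> \<le> (\<Sum>k=1..n. L1_norm m (partial_sum m k (wave_atom J L)))"
    proof (rule sum_blocks_le)
      show "L1_norm m (partial_sum m 0 (wave_atom J L)) = 0"
        by (simp add: L1_norm_def partial_sum_def)
    qed (use A in \<open>auto simp: L1_norm_nonneg\<close>)
    finally show "real n / 96 * \<beta> \<le> (\<Sum>k=1..n. L1_norm m (partial_sum m k (wave_atom J L)))" .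
  qed
  show ?thesis
  proof (cases "n < 64 * M J")
    \<comment> \<open>A single block is already a fixed share of 1..n: for the full cycle L = p the
      digit a = 1 satisfies a L = p. The threshold 64 times the 4 in the logarithm is the origin of
      256.\<close>
    case True
    then have "real n < real (64 * M J)" by (simp only: of_nat_less_iff)
    then have r: "real n < 64 * real (M J)" by simp
    show ?thesis
      unfolding \<beta>_def[symmetric]
    proof (rule key[of p "{1}"])
      show "{0..<p} \<in> dyadic_blocks p" by (rule dyadic_blocks.whole)
      show "real n \<le> 96 * (real (card {1::nat}) * real (M J))" using r by simp
      show "real n / 256 \<le> real (M J) * real p / (4 * real p)" using r p2 by simp
    qed (use p2 J1 in auto)
  next
    case False
    define q where "q = n div M J"
    have q64: "q \<ge> 64" using False by (simp add: q_def less_eq_div_iff_mult_less_eq)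
    have q2p: "q < 2 * p" using J2 by (simp add: q_def less_mult_imp_div_less mult.assoc)
    obtain j where j: "2 ^ j \<le> q" "q < 2 ^ (j + 1)"
      using ex_power_ivl1[of 2 q] q64 by auto
    have "(2::nat) ^ 6 < 2 ^ (j + 1)" using j q64 by simp
    then have "6 < j + 1"
      by (simp only: power_strict_increasing_iff)
    \<comment> \<open>The shift by 2 leaves room: 4 * 2 ^ i \<le> q < 2 p makes \<open>L\<close> at
      least 2, and the digits up to u < 2 * 2 ^ i stay below q.\<close>
    define i where "i = j - 2"
    have i: "j = i + 2" "4 \<le> i"
      using \<open>6 < j + 1\<close> by (simp_all add: i_def)
    have q1: "4 * 2 ^ i \<le> q" and q2: "q + 1 \<le> 8 * 2 ^ i"
      using j by (simp_all add: i)
    have i16: "16 \<le> (2::nat) ^ i"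
      using power_increasing[OF i(2), of "2::nat"] by simp
    define L where "L = p div 2 ^ i"
    define u where "u = p div L"
    have L2: "2 \<le> L"
      using q1 q2p unfolding L_def by (simp add: less_eq_div_iff_mult_less_eq)
    have Lp: "L \<le> p" by (simp add: L_def)
    have u1: "2 ^ i \<le> u"
      using L2 unfolding u_def by (subst less_eq_div_iff_mult_less_eq) (auto simp: L_def)
    have "p < 2 ^ i * (L + 1)"
      unfolding L_def by (simp add: dividend_less_times_div)
    also have "\<dots> \<le> 2 ^ i * (2 * L)"
      using L2 by (intro mult_left_mono) auto
    finally have "p < (2 * 2 ^ i) * L" by simp
    then have u2: "u < 2 * 2 ^ i"
      unfolding u_def by (rule less_mult_imp_div_less)
    have uL: "u * L \<le> p" by (simp add: u_def)
    have pu: "p < (u + 1) * L"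
      using L2 dividend_less_div_times[of L p] by (simp add: u_def add.commute)
    have n8: "real n < 8 * 2 ^ i * real (M J)"
    proof -
      have "n < (q + 1) * M J"
        using dividend_less_div_times[of "M J" n] by (simp add: q_def add.commute)
      also have "\<dots> \<le> 8 * 2 ^ i * M J"
        using q2 by (intro mult_right_mono) auto
      finally have "real n < real (8 * 2 ^ i * M J)"
        by (simp only: of_nat_less_iff)
      then show ?thesis by simp
    qed
    \<comment> \<open>\<open>u\<close> is the largest digit with u L \<le> p. Going down by a
      twelfth keeps 5 (u + 1) \<le> 6 a, because u \<ge> 16, and leaves at least 2 ^ i / 12 digits;
      with n < 8 * 2 ^ i M_J this gives 96 = 8 * 12.\<close>
    show ?thesis
      unfolding \<beta>_def[symmetric]
    proof (rule key[of L "{u - u div 12..u}"])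
      show "{0..<L} \<in> dyadic_blocks p"
        unfolding L_def using L2 by (intro initial_dyadic_block) (simp add: L_def)
      show "5 * p \<le> 6 * (a * L) \<and> a * L \<le> p \<and> (a + 1) * M J \<le> n" if a: "a \<in> {u - u div 12..u}" for a
      proof (intro conjI)
        have "5 * (u + 1) \<le> 6 * a"
          using a u1 i16 by auto
        then have "5 * (u + 1) * L \<le> 6 * a * L"
          by (rule mult_right_mono) simp
        moreover have "5 * p \<le> 5 * (u + 1) * L"
          using pu by (simp only: mult.assoc)
        ultimately show "5 * p \<le> 6 * (a * L)"
          by (simp only: mult.assoc)
        have "a * L \<le> u * L" using a by simp
        then show "a * L \<le> p" using uL by linarith
        have "a + 1 \<le> q" using a u2 q1 by simp
        then have "(a + 1) * M J \<le> q * M J" by (rule mult_right_mono) simp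
        also have "\<dots> \<le> n" by (simp add: q_def)
        finally show "(a + 1) * M J \<le> n" .
      qed
      have "2 ^ i \<le> 12 * card {u - u div 12..u}"
        using u1 by (simp add: Suc_diff_le)
      then have "real (2 ^ i) \<le> real (12 * card {u - u div 12..u})"
        by (simp only: of_nat_le_iff)
      then have "8 * 2 ^ i * real (M J) \<le> 8 * (12 * real (card {u - u div 12..u})) * real (M J)"
        by (intro mult_right_mono mult_left_mono) auto
      also have "\<dots> = 96 * (real (card {u - u div 12..u}) * real (M J))"
        by simp
      finally show "real n \<le> 96 * (real (card {u - u div 12..u}) * real (M J))"
        using n8 by (rule order_trans[OF less_imp_le, rotated])
      have "2 ^ i * L \<le> p"
        by (simp add: L_def)
      then have "real (2 ^ i * L) \<le> real p"
        by (simp only: of_nat_le_iff)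
      then have "2 ^ i \<le> real p / real L"
        using L2 by (simp add: le_divide_eq)
      then have "real (M J) * 2 ^ i / 4 \<le> real (M J) * (real p / real L) / 4"
        by (intro divide_right_mono mult_left_mono) auto
      moreover have "real n / 256 \<le> real (M J) * 2 ^ i / 4"
      proof -
        have "0 \<le> real (M J) * 2 ^ i" by simp
        moreover have "real n < 8 * (real (M J) * 2 ^ i)" using n8 by (simp only: mult_ac)
        ultimately show ?thesis by linarith
      qed
      moreover have "real (M J) * (real p / real L) / 4 = real (M J) * real p / (4 * real L)"
        by simp
      ultimately show "real n / 256 \<le> real (M J) * real p / (4 * real L)"
        by linarith
    qed (use L2 Lp in auto)
  qed
qed

lemma ex_atom_mean_L1_norm_ge:
  obtains c :: real and n0 :: nat where "c > 0" "n0 \<ge> 2"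
    "\<And>n. n \<ge> n0 \<Longrightarrow> \<exists>f. atom m f \<and> c * ln (real n) \<le> (\<Sum>k=1..n. L1_norm m (partial_sum m k f)) / real n"
proof
  \<comment> \<open>Beyond \<open>n0\<close> the constants ln 256 and 12 pi = 3 * 4 pi absorb at
    most half of ln n. This leaves ln n / (8 pi), hence the factor 1 / (96 * 8 pi).\<close>
  define n0 where "n0 = nat \<lceil>exp (2 * ln 256 + 24 * pi)\<rceil> + 2"
  show "1 / (768 * pi) > 0" by simp
  show "n0 \<ge> 2" by (simp add: n0_def)
  fix n assume n: "n \<ge> n0"
  then have n2: "n \<ge> 2" by (simp add: n0_def)
  have "exp (2 * ln 256 + 24 * pi) \<le> real n0"
    unfolding n0_def by linarith
  also have "\<dots> \<le> real n" using n by simp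
  finally have l: "2 * ln 256 + 24 * pi \<le> ln (real n)"
    using n2 by (simp add: ln_ge_iff)
  have eq: "ln (real n / 256) = ln (real n) - ln 256"
    using n2 by (simp add: ln_div)
  have "ln (real n) / (8 * pi) + 3 = (ln (real n) / 2 + 12 * pi) / (4 * pi)"
    by (simp add: add_divide_distrib)
  also have "\<dots> \<le> (ln (real n) - ln 256) / (4 * pi)"
    using l by (intro divide_right_mono) auto
  finally have \<beta>: "ln (real n) / (8 * pi) \<le> ln (real n / 256) / (4 * pi) - 3"
    by (simp add: eq)
  moreover have "0 \<le> ln (real n) / (8 * pi)" using n2 by simp
  ultimately obtain f where f: "atom m f"
    "(\<Sum>k=1..n. L1_norm m (partial_sum m k f)) \<ge> real n / 96 * (ln (real n / 256) / (4 * pi) - 3)"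
    using ex_atom_sum_L1_norm_ge[OF n2] by fastforce
  have "real n / 96 * (ln (real n) / (8 * pi)) \<le> real n / 96 * (ln (real n / 256) / (4 * pi) - 3)"
    using \<beta> by (intro mult_left_mono) auto
  then have "real n / 96 * (ln (real n) / (8 * pi)) \<le> (\<Sum>k=1..n. L1_norm m (partial_sum m k f))"
    using f(2) by linarith
  then have "1 / (768 * pi) * ln (real n) \<le> (\<Sum>k=1..n. L1_norm m (partial_sum m k f)) / real n"
    using n2 by (simp add: le_divide_eq mult_ac)
  then show "\<exists>f. atom m f \<and> 1 / (768 * pi) * ln (real n) \<le> (\<Sum>k=1..n. L1_norm m (partial_sum m k f)) / real n"
    using f(1) by blast
qed

section \<open>Series of atoms with chosen signs\<close>

text \<open>Summability of the L1 norms gives absolute convergence almost everywhere, so the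
  pointwise sum is the limit in L1; its value on the exceptional null set is immaterial. The
  explicit tail bound is exported because it later controls the atoms beyond a given step.\<close>

lemma hardy_space_suminf:
  assumes a: "\<And>i. atom m (a i)" and c: "summable (\<lambda>i. norm (c i))"
  obtains f where "f \<in> hardy_space m" "integrable G f"
    "\<And>N. L1_norm m (\<lambda>x. f x - (\<Sum>i<N. c i * a i x)) \<le> (\<Sum>i. norm (c (i + N)))"
proof -
  let ?u = "\<lambda>i x. c i * a i x"
  have int: "integrable G (?u i)" for i
    using integrable_atom[OF a] by simp
  have nu: "L1_norm m (?u i) \<le> norm (c i)" for i
    using L1_norm_atom_le[OF a, of i] by (simp add: L1_norm_cmult mult_left_le)
  have summ: "summable (\<lambda>i. L1_norm m (?u i))"
    by (rule summable_comparison_test'[OF c]) (use nu in \<open>auto simp: L1_norm_nonneg\<close>)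
  have ae: "AE x in G. summable (\<lambda>i. norm (?u i x))"
  proof -
    have "(\<integral>\<^sup>+x. (\<Sum>i. ennreal (norm (?u i x))) \<partial>G) = (\<Sum>i. \<integral>\<^sup>+x. norm (?u i x) \<partial>G)"
      using int by (intro nn_integral_suminf) auto
    also have "\<dots> = (\<Sum>i. ennreal (L1_norm m (?u i)))"
      unfolding L1_norm_def using int by (intro suminf_cong nn_integral_eq_integral) auto
    also have "\<dots> \<noteq> \<infinity>"
      using summ by (simp add: suminf_ennreal2 L1_norm_nonneg)
    finally have "AE x in G. (\<Sum>i. ennreal (norm (?u i x))) \<noteq> \<infinity>"
      using int by (intro nn_integral_PInf_AE) auto
    then show ?thesis
      by eventually_elim (auto intro: summable_suminf_not_top)
  qed
  have tail: "AE x in G. summable (\<lambda>i. norm (?u (i + N) x))" for N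
    using ae by eventually_elim (subst summable_iff_shift)
  have sN: "summable (\<lambda>i. LINT x|G. norm (?u (i + N) x))" for N
    using summ unfolding L1_norm_def by (subst summable_iff_shift)
  define f where "f = (\<lambda>x. \<Sum>i. ?u i x)"
  have f: "integrable G f"
    unfolding f_def using int ae summ unfolding L1_norm_def by (rule integrable_suminf)
  have bound: "L1_norm m (\<lambda>x. f x - (\<Sum>i<N. ?u i x)) \<le> (\<Sum>i. norm (c (i + N)))" for N
  proof -
    have "L1_norm m (\<lambda>x. f x - (\<Sum>i<N. ?u i x)) \<le> (LINT x|G. (\<Sum>i. norm (?u (i + N) x)))"
      unfolding L1_norm_def
    proof (rule integral_mono_AE)
      show "integrable G (\<lambda>x. norm (f x - (\<Sum>i<N. ?u i x)))"
        using f int by (intro integrable_norm Bochner_Integration.integrable_diff Bochner_Integration.integrable_sum) auto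
      show "integrable G (\<lambda>x. \<Sum>i. norm (?u (i + N) x))"
        using int tail[of N] sN[of N] by (intro integrable_suminf) auto
      show "AE x in G. norm (f x - (\<Sum>i<N. ?u i x)) \<le> (\<Sum>i. norm (?u (i + N) x))"
        using ae
      proof eventually_elim
        case (elim x)
        have "f x - (\<Sum>i<N. ?u i x) = (\<Sum>i. ?u (i + N) x)"
          using suminf_split_initial_segment[OF summable_norm_cancel[OF elim], of N] by (simp add: f_def)
        moreover have "summable (\<lambda>i. norm (?u (i + N) x))"
          using elim by (subst summable_iff_shift)
        ultimately show ?case by (simp only: summable_norm)
      qed
    qed
    also have "\<dots> = (\<Sum>i. LINT x|G. norm (?u (i + N) x))"
      using int tail[of N] sN[of N] by (intro integral_suminf) auto
    also have "\<dots> \<le> (\<Sum>i. norm (c (i + N)))"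
    proof (rule suminf_le[OF _ sN])
      show "summable (\<lambda>i. norm (c (i + N)))"
        using c by (subst summable_iff_shift)
    qed (use nu in \<open>auto simp: L1_norm_def\<close>)
    finally show ?thesis .
  qed
  have lim0: "(\<lambda>N. \<Sum>i. norm (c (i + N))) \<longlonglongrightarrow> 0"
    using suminf_exist_split2[OF c] .
  have "(\<lambda>N. L1_norm m (\<lambda>x. f x - (\<Sum>i<N. ?u i x))) \<longlonglongrightarrow> 0"
    using tendsto_const lim0
    by (rule tendsto_sandwich[rotated 2]) (auto simp: L1_norm_nonneg bound)
  then have "f \<in> hardy_space m"
    using a c f unfolding hardy_space_def atomic_decomposition_def by blast
  then show ?thesis using f bound by (rule that)
qed

lemma partial_sum_add:
  assumes "integrable G f" "integrable G g"
  shows "partial_sum m k (\<lambda>x. f x + g x) x = partial_sum m k f x + partial_sum m k g x"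
proof -
  have int: "integrable G (\<lambda>y. h y * cnj (vilenkin m j y))" if "integrable G h" for h j
    using that
    by (rule Bochner_Integration.integrable_bound)
      (use that in \<open>auto simp: norm_mult intro!: borel_measurable_times measurable_cnj_vilenkin\<close>)
  show ?thesis
    using assms int
    by (simp add: partial_sum_def fourier_coeff_def distrib_right sum.distrib)
qed

lemma partial_sum_cmult: "partial_sum m k (\<lambda>x. c * f x) x = c * partial_sum m k f x"
  by (simp add: partial_sum_def fourier_coeff_def sum_distrib_left mult.assoc)

definition mean_norm :: "nat \<Rightarrow> ((nat \<Rightarrow> nat) \<Rightarrow> complex) \<Rightarrow> real" where
  "mean_norm n f = (\<Sum>k=1..n. L1_norm m (partial_sum m k f)) / real n"

lemma mean_norm_add_le:
  assumes "integrable G f" "integrable G g"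
  shows "mean_norm n (\<lambda>x. f x + g x) \<le> mean_norm n f + mean_norm n g"
proof -
  have "L1_norm m (partial_sum m k (\<lambda>x. f x + g x)) \<le> L1_norm m (partial_sum m k f) + L1_norm m (partial_sum m k g)" for k
    using L1_norm_add_le[of "partial_sum m k f" "partial_sum m k g"]
    by (simp add: partial_sum_add[OF assms, abs_def])
  then have "(\<Sum>k=1..n. L1_norm m (partial_sum m k (\<lambda>x. f x + g x)))
      \<le> (\<Sum>k=1..n. L1_norm m (partial_sum m k f)) + (\<Sum>k=1..n. L1_norm m (partial_sum m k g))"
    unfolding sum.distrib[symmetric] by (rule sum_mono)
  then show ?thesis
    by (simp add: mean_norm_def add_divide_distrib[symmetric] divide_right_mono)
qed

lemma mean_norm_cmult: "mean_norm n (\<lambda>x. c * f x) = norm c * mean_norm n f"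
  by (simp add: mean_norm_def partial_sum_cmult[abs_def] L1_norm_cmult sum_distrib_left)

lemma mean_norm_le:
  assumes "integrable G f" "n \<ge> 2"
  shows "mean_norm n f \<le> 12 * ln (real n) * L1_norm m f"
proof -
  have l: "ln (real n) \<ge> 2 / 3"
    using ln2_ge_two_thirds ln_mono[of 2 "real n"] assms(2) by linarith
  have "(\<Sum>k=1..n. L1_norm m (partial_sum m k f)) \<le> (\<Sum>k=1..n. 12 * ln (real n) * L1_norm m f)"
  proof (rule sum_mono)
    fix k assume k: "k \<in> {1..n}"
    have "L1_norm m (partial_sum m k f) \<le> (3 + 7 * ln (real k)) * L1_norm m f"
      using k by (intro L1_norm_partial_sum_le assms) auto
    also have "\<dots> \<le> 12 * ln (real n) * L1_norm m f"
    proof (rule mult_right_mono[OF _ L1_norm_nonneg])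
      have "ln (real k) \<le> ln (real n)" using k by (intro ln_mono) auto
      \<comment> \<open>As ln n \<ge> 2/3, the 3 is at most 9/2 ln n, and 7 + 9/2 < 12.\<close>
      then show "3 + 7 * ln (real k) \<le> 12 * ln (real n)" using l by linarith
    qed
    finally show "L1_norm m (partial_sum m k f) \<le> 12 * ln (real n) * L1_norm m f" .
  qed
  also have "\<dots> = 12 * ln (real n) * L1_norm m f * real n"
    by simp
  finally show ?thesis
    using assms(2) by (simp add: mean_norm_def divide_le_eq)
qed

text \<open>
  Of \<open>X + v\<close> and \<open>X - v\<close> at least one has a mean norm not smaller than that of \<open>v\<close>. Choosing the sign
  in this way at every step keeps all earlier terms harmless, so the indices can be chosen in advance.
\<close>

fun signed_sum :: "real \<Rightarrow> (nat \<Rightarrow> nat) \<Rightarrow> (nat \<Rightarrow> (nat \<Rightarrow> nat) \<Rightarrow> complex) \<Rightarrow> nat \<Rightarrow> (nat \<Rightarrow> nat) \<Rightarrow> complex" where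
  "signed_sum q N a 0 = (\<lambda>x. 0)"
| "signed_sum q N a (Suc i) =
    (if mean_norm (N i) (a i) * q ^ i \<le> mean_norm (N i) (\<lambda>x. signed_sum q N a i x + of_real (q ^ i) * a i x)
     then (\<lambda>x. signed_sum q N a i x + of_real (q ^ i) * a i x)
     else (\<lambda>x. signed_sum q N a i x + - of_real (q ^ i) * a i x))"

text \<open>A sign once chosen is never revised, so all these functions are partial sums of one
  series of atoms, to which \<open>hardy_space_suminf\<close> can be applied.\<close>

lemma signed_sum_eq:
  "\<exists>c. (\<forall>i. norm (c i) = \<bar>q ^ i\<bar>) \<and> (\<forall>n x. signed_sum q N a n x = (\<Sum>i<n. c i * a i x))"
proof -
  define c :: "nat \<Rightarrow> complex" where "c = (\<lambda>i.
    if mean_norm (N i) (a i) * q ^ i \<le> mean_norm (N i) (\<lambda>x. signed_sum q N a i x + of_real (q ^ i) * a i x)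
    then of_real (q ^ i) else - of_real (q ^ i))"
  have "signed_sum q N a n x = (\<Sum>i<n. c i * a i x)" for n x
    by (induction n) (auto simp: c_def)
  moreover have "norm (c i) = \<bar>q ^ i\<bar>" for i
    unfolding c_def by (simp only: norm_of_real norm_minus_cancel split: if_split) simp
  ultimately show ?thesis by blast
qed

text \<open>With X the previous sum and v the new term, 2 v = (X + v) - (X - v); if the test rejects
  X + v, the triangle inequality makes X - v large enough.\<close>

lemma mean_norm_signed_sum_Suc_ge:
  assumes "0 \<le> q" "integrable G (signed_sum q N a i)" "integrable G (a i)"
  shows "mean_norm (N i) (signed_sum q N a (Suc i)) \<ge> q ^ i * mean_norm (N i) (a i)"
proof -
  let ?X = "signed_sum q N a i" and ?v = "\<lambda>x. of_real (q ^ i) * a i x"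
  let ?p = "\<lambda>x. ?X x + ?v x" and ?n = "\<lambda>x. ?X x + - of_real (q ^ i) * a i x"
  have int: "integrable G ?p" "integrable G ?n"
    using assms by auto
  have "2 * (q ^ i * mean_norm (N i) (a i)) = mean_norm (N i) (\<lambda>x. of_real (2 * q ^ i) * a i x)"
    unfolding mean_norm_cmult using assms(1) by (simp add: norm_mult norm_power)
  also have "(\<lambda>x. of_real (2 * q ^ i) * a i x) = (\<lambda>x. ?p x + (-1) * ?n x)"
    by (auto simp: algebra_simps)
  also have "mean_norm (N i) (\<lambda>x. ?p x + (-1) * ?n x) \<le> mean_norm (N i) ?p + mean_norm (N i) (\<lambda>x. (-1) * ?n x)"
    using int by (intro mean_norm_add_le integrable_mult_right) auto
  also have "mean_norm (N i) (\<lambda>x. (-1) * ?n x) = mean_norm (N i) ?n"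
    unfolding mean_norm_cmult by simp
  finally have "2 * (q ^ i * mean_norm (N i) (a i)) \<le> mean_norm (N i) ?p + mean_norm (N i) ?n" .
  then show ?thesis
    by (cases "mean_norm (N i) (a i) * q ^ i \<le> mean_norm (N i) ?p") (simp_all add: mult.commute)
qed

theorem ex_hardy_unbounded_mean:
  fixes \<phi> :: "nat \<Rightarrow> real"
  assumes \<phi>: "\<And>n. n \<ge> 1 \<Longrightarrow> \<phi> n \<ge> 1"
    and ls: "limsup (\<lambda>n. ereal (ln (real n) / \<phi> n)) = \<infinity>"
  shows "\<exists>f\<in>hardy_space m. \<forall>K. \<exists>n\<ge>1. K \<le> mean_norm n f / \<phi> n"
proof -
  obtain c n0 where c: "c > 0" and n0: "n0 \<ge> 2"
    and ex: "\<And>n. n \<ge> n0 \<Longrightarrow> \<exists>f. atom m f \<and> c * ln (real n) \<le> mean_norm n f"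
    unfolding mean_norm_def by (rule ex_atom_mean_L1_norm_ge) blast
  \<comment> \<open>The atoms after the i-th have total weight at most 2 q ^ (i + 1) and can cost 12
    ln n times that much; 48 q \<le> c makes this at most half of the gain c q ^ i ln n.\<close>
  define q where "q = min (1 / 2) (c / 48)"
  have q: "0 < q" "q \<le> 1 / 2" "48 * q \<le> c"
    using c by (auto simp: q_def)
  have big: "\<exists>n\<ge>n0. K \<le> ln (real n) / \<phi> n" for K
  proof (rule ccontr)
    assume "\<not> (\<exists>n\<ge>n0. K \<le> ln (real n) / \<phi> n)"
    then have "ereal (ln (real n) / \<phi> n) \<le> ereal K" if "n \<ge> n0" for n
      using that by force
    then have "eventually (\<lambda>n. ereal (ln (real n) / \<phi> n) \<le> ereal K) sequentially"
      by (auto simp: eventually_sequentially)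
    then have "limsup (\<lambda>n. ereal (ln (real n) / \<phi> n)) \<le> ereal K"
      by (rule Limsup_bounded)
    then show False using ls by simp
  qed
  \<comment> \<open>The threshold anticipates what survives at step i, namely (c / 2) q ^ i ln n,
    which divided by \<phi> must reach i.\<close>
  have "\<forall>i. \<exists>n\<ge>n0. real i * 2 / (c * q ^ i) \<le> ln (real n) / \<phi> n"
    using big by blast
  then obtain N where N: "\<And>i. N i \<ge> n0" "\<And>i. real i * 2 / (c * q ^ i) \<le> ln (real (N i)) / \<phi> (N i)"
    by metis
  have "\<forall>i. \<exists>f. atom m f \<and> c * ln (real (N i)) \<le> mean_norm (N i) f"
    using ex N by blast
  then obtain a where a: "\<And>i. atom m (a i)" "\<And>i. c * ln (real (N i)) \<le> mean_norm (N i) (a i)"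
    by metis
  obtain d where d: "\<And>i. norm (d i) = \<bar>q ^ i\<bar>" and X: "\<And>n x. signed_sum q N a n x = (\<Sum>i<n. d i * a i x)"
    using signed_sum_eq[of q N a] by blast
  have nd: "norm (d i) = q ^ i" for i using d q by simp
  have qs: "summable (\<lambda>i. q ^ i)"
    using q by (intro summable_geometric) auto
  obtain f where f: "f \<in> hardy_space m" "integrable G f"
    and tail: "\<And>n. L1_norm m (\<lambda>x. f x - (\<Sum>i<n. d i * a i x)) \<le> (\<Sum>i. norm (d (i + n)))"
    using hardy_space_suminf[of a d] a(1) qs unfolding nd by blast
  have intX: "integrable G (signed_sum q N a n)" for n
    unfolding X[abs_def] using integrable_atom[OF a(1)]
    by (intro Bochner_Integration.integrable_sum integrable_mult_right)
  have main: "real i \<le> mean_norm (N i) f / \<phi> (N i)" for i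
  proof -
    let ?n = "N i" and ?X = "signed_sum q N a (Suc i)"
    have n2: "?n \<ge> 2" using N(1)[of i] n0 by simp
    have l: "ln (real ?n) \<ge> 0" using n2 by simp
    have ph: "\<phi> ?n \<ge> 1" using \<phi> n2 by simp
    have "(\<Sum>j. q ^ (j + Suc i)) = 1 / (1 - q) * q ^ Suc i"
      unfolding power_add[of q _ "Suc i"]
      using suminf_mult2[OF qs, of "q ^ Suc i"] suminf_geometric[of q] q by simp
    also have "\<dots> \<le> 2 * q ^ Suc i"
      using q by (intro mult_right_mono) (auto simp: divide_le_eq)
    finally have tl: "L1_norm m (\<lambda>x. f x - ?X x) \<le> 2 * q ^ Suc i"
      using tail[of "Suc i"] unfolding X nd by simp
    have intd: "integrable G (\<lambda>x. (-1) * (f x - ?X x))"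
      by (intro integrable_mult_right Bochner_Integration.integrable_diff f(2) intX)
    have "q ^ i * (c * ln (real ?n)) \<le> q ^ i * mean_norm ?n (a i)"
      using a(2) q by (intro mult_left_mono) auto
    also have "\<dots> \<le> mean_norm ?n ?X"
      using q intX integrable_atom[OF a(1)] by (intro mean_norm_signed_sum_Suc_ge) auto
    also have "?X = (\<lambda>x. f x + (-1) * (f x - ?X x))"
      by (simp add: fun_eq_iff)
    also have "mean_norm ?n \<dots> \<le> mean_norm ?n f + mean_norm ?n (\<lambda>x. (-1) * (f x - ?X x))"
      using f intd by (intro mean_norm_add_le)
    also have "mean_norm ?n (\<lambda>x. (-1) * (f x - ?X x)) \<le> 12 * ln (real ?n) * L1_norm m (\<lambda>x. (-1) * (f x - ?X x))"
      using intd n2 by (rule mean_norm_le)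
    also have "L1_norm m (\<lambda>x. (-1) * (f x - ?X x)) = L1_norm m (\<lambda>x. f x - ?X x)"
      unfolding L1_norm_cmult by simp
    also have "12 * ln (real ?n) * \<dots> \<le> 12 * ln (real ?n) * (2 * q ^ Suc i)"
      using tl l by (intro mult_left_mono) auto
    also have "12 * ln (real ?n) * (2 * q ^ Suc i) \<le> q ^ i * (c / 2 * ln (real ?n))"
      using mult_right_mono[OF q(3), of "q ^ i * ln (real ?n)"] q(1) l by (simp add: mult_ac)
    finally have "q ^ i * (c * ln (real ?n)) \<le> mean_norm ?n f + q ^ i * (c / 2 * ln (real ?n))"
      by simp
    then have "q ^ i * c / 2 * ln (real ?n) \<le> mean_norm ?n f"
      by (simp add: algebra_simps)
    then have "q ^ i * c / 2 * ln (real ?n) / \<phi> ?n \<le> mean_norm ?n f / \<phi> ?n"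
      using ph by (intro divide_right_mono) auto
    moreover have "real i \<le> q ^ i * c / 2 * (ln (real ?n) / \<phi> ?n)"
      using mult_left_mono[OF N(2)[of i], of "q ^ i * c / 2"] q(1) c by (simp add: field_simps)
    ultimately show ?thesis by simp
  qed
  have "\<exists>n\<ge>1. K \<le> mean_norm n f / \<phi> n" for K
  proof -
    obtain i where "K \<le> real i" using real_arch_simple by blast
    then show ?thesis
      using main[of i] N(1)[of i] n0 by (intro exI[of _ "N i"]) auto
  qed
  then show ?thesis using f(1) by blast
qed

end

theorem theorem1:
  shows "(\<exists>c::real. c > 0 \<and>
           (\<forall>m :: nat \<Rightarrow> nat. (\<forall>k. m k \<ge> 2) \<longrightarrow>
             (\<forall>f \<in> hardy_space m.
               (SUP n\<in>{2::nat..}. ereal (1 / (real n * ln (real n)) *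
                   (\<Sum>k=1..n. L1_norm m (partial_sum m k f))))
                 \<le> ereal (c * hardy_norm m f))))
       \<and> (\<forall>(m :: nat \<Rightarrow> nat) (\<phi> :: nat \<Rightarrow> real).
           (\<forall>k. m k \<ge> 2) \<longrightarrow>
           (\<forall>n\<ge>1. \<phi> n \<ge> 1) \<longrightarrow>
           mono_on {1..} \<phi> \<longrightarrow>
           limsup (\<lambda>n. ereal (ln (real n) / \<phi> n)) = \<infinity> \<longrightarrow>
           (\<exists>f \<in> hardy_space m.
             (SUP n\<in>{1::nat..}. ereal (1 / (real n * \<phi> n) *
                 (\<Sum>k=1..n. L1_norm m (partial_sum m k f)))) = \<infinity>))"
proof (rule conjI)
  show "\<exists>c::real. c > 0 \<and>
           (\<forall>m :: nat \<Rightarrow> nat. (\<forall>k. m k \<ge> 2) \<longrightarrow>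
             (\<forall>f \<in> hardy_space m.
               (SUP n\<in>{2::nat..}. ereal (1 / (real n * ln (real n)) *
                   (\<Sum>k=1..n. L1_norm m (partial_sum m k f))))
                 \<le> ereal (c * hardy_norm m f)))"
  \<comment> \<open>The 12 of \<open>mean_norm_le\<close> is supplied before \<open>m\<close> is
    fixed, which is what makes the constant absolute.\<close>
  proof (intro exI[of _ 12] conjI allI impI ballI SUP_least)
    fix m :: "nat \<Rightarrow> nat" and f n
    assume m: "\<forall>k. m k \<ge> 2" and f: "f \<in> hardy_space m" and n: "n \<in> {2::nat..}"
    interpret vilenkin_system m using m by unfold_locales auto
    have int: "integrable (vilenkin_group m) f" using f by (simp add: hardy_space_def)
    have n2: "n \<ge> 2" using n by simp
    have l: "ln (real n) > 0" using n2 by simp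
    have "mean_norm n f \<le> 12 * ln (real n) * hardy_norm m f"
      using mean_norm_le[OF int n2] mult_left_mono[OF L1_norm_le_hardy_norm[OF f], of "12 * ln (real n)"] l
      by linarith
    then have "mean_norm n f / ln (real n) \<le> 12 * hardy_norm m f"
      using l by (simp add: divide_le_eq mult_ac)
    then show "ereal (1 / (real n * ln (real n)) * (\<Sum>k=1..n. L1_norm m (partial_sum m k f)))
        \<le> ereal (12 * hardy_norm m f)"
      by (simp add: mean_norm_def)
  qed simp
  show "\<forall>(m :: nat \<Rightarrow> nat) (\<phi> :: nat \<Rightarrow> real).
           (\<forall>k. m k \<ge> 2) \<longrightarrow>
           (\<forall>n\<ge>1. \<phi> n \<ge> 1) \<longrightarrow>
           mono_on {1..} \<phi> \<longrightarrow>
           limsup (\<lambda>n. ereal (ln (real n) / \<phi> n)) = \<infinity> \<longrightarrow>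
           (\<exists>f \<in> hardy_space m.
             (SUP n\<in>{1::nat..}. ereal (1 / (real n * \<phi> n) *
                 (\<Sum>k=1..n. L1_norm m (partial_sum m k f)))) = \<infinity>)"
  proof (intro allI impI)
    fix m :: "nat \<Rightarrow> nat" and \<phi> :: "nat \<Rightarrow> real"
    assume m: "\<forall>k. m k \<ge> 2" and \<phi>: "\<forall>n\<ge>1. \<phi> n \<ge> 1"
      and ls: "limsup (\<lambda>n. ereal (ln (real n) / \<phi> n)) = \<infinity>"
    interpret vilenkin_system m using m by unfold_locales auto
    obtain f where f: "f \<in> hardy_space m" and ub: "\<And>K. \<exists>n\<ge>1. K \<le> mean_norm n f / \<phi> n"
      using ex_hardy_unbounded_mean[of \<phi>] \<phi> ls by blast
    have "ereal K \<le> (SUP n\<in>{1::nat..}. ereal (1 / (real n * \<phi> n) * (\<Sum>k=1..n. L1_norm m (partial_sum m k f))))" for K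
    proof -
      obtain n where n: "n \<ge> 1" "K \<le> mean_norm n f / \<phi> n" using ub by blast
      have "ereal K \<le> ereal (1 / (real n * \<phi> n) * (\<Sum>k=1..n. L1_norm m (partial_sum m k f)))"
        using n(2) by (simp add: mean_norm_def)
      then show ?thesis using n(1) by (intro SUP_upper2[of n]) auto
    qed
    then have "(SUP n\<in>{1::nat..}. ereal (1 / (real n * \<phi> n) * (\<Sum>k=1..n. L1_norm m (partial_sum m k f)))) = \<infinity>"
      by (intro ereal_top) auto
    then show "\<exists>f \<in> hardy_space m.
             (SUP n\<in>{1::nat..}. ereal (1 / (real n * \<phi> n) *
                 (\<Sum>k=1..n. L1_norm m (partial_sum m k f)))) = \<infinity>"
      using f by blast
  qed
qed

end
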